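(* Let $(\alpha,\beta)\in\{(2,2),(4,4),(6,4),(10,4)\}$, let $k$ be a non-negative integer, and let $\mathcal{C}$ be a self-dual $\mathbb{Z}_4$-code of length $24k+\alpha$ and minimum Lee weight $8k+\beta$. Then any binary self-dual code $C$ (of length $24k+\alpha$) containing the residue code $\mathcal{C}^{(1)}$ is an s-extremal self-dual code having minimum weight $4k+2$.
   Context: A $\mathbb{Z}_4$-code of length $n$ is a $\mathbb{Z}_4$-submodule $\mathcal{C}$ of $\mathbb{Z}_4^n$, where $\mathbb{Z}_4=\{0,1,2,3\}$ is the ring of integers modulo $4$. Its dual is $\mathcal{C}^\perp=\{x\in\mathbb{Z}_4^n \mid x\cdot y=0 \text{ for all } y\in\mathcal{C}\}$, with $x\cdot y$ the standard inner product; $\mathcal{C}$ is self-dual if $\mathcal{C}=\mathcal{C}^\perp$. For $x\in\mathbb{Z}_4^n$ let $n_i(x)$ be the number of components of $x$ equal to $i$. The Lee weight of $x$ is $n_1(x)+2n_2(x)+n_3(x)$, and the minimum Lee weight of $\mathcal{C}$ is the smallest Lee weight among all non-zero codewords of $\mathcal{C}$. The residue code of $\mathcal{C}$ is the binary code $\mathcal{C}^{(1)}=\{c \bmod 2 \mid c\in\mathcal{C}\}$. A binary code is a linear subspace of $\mathbb{Z}_2^n$; it is self-dual if it equals its dual under the standard inner product. A binary self-dual code is doubly even if all codewords have weight divisible by $4$, and singly even if some codeword has weight congruent to $2$ modulo $4$ (a doubly even self-dual code of length $n$ exists only if $n\equiv 0\pmod 8$). For a binary singly even self-dual code $C$, let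 $C_0$ be the subcode of codewords of weight congruent to $0$ modulo $4$; the shadow of $C$ is $S=C_0^\perp\setminus C$. Let $d(C)$ be the minimum weight of $C$ and $d(S)$ the minimum weight of the vectors in $S$. It is known that a binary self-dual code $C$ of length $n$ with shadow $S$ satisfies $d(S)\le \frac{n}{2}+4-2d(C)$, except when $n\equiv 22\pmod{24}$ and $d(C)=4\lfloor n/24\rfloor+6$, where $d(S)=\frac{n}{2}+8-2d(C)$. The code $C$ is called s-extremal if it meets this bound, i.e. $d(S)=\frac{n}{2}+4-2d(C)$ (respectively $d(S)=\frac{n}{2}+8-2d(C)$ in the exceptional case). *)

theory Defs
  imports "HOL-Analysis.Analysis" "HOL-Library.Numeral_Type" "HOL-Library.Z2"
begin

text \<open>The ring of integers modulo 4 is the numeral type \<^typ>\<open>4\<close>, the binary field is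
  \<^typ>\<open>bit\<close>. Codes of length \<open>n\<close> live in \<open>4 ^ 'n\<close> resp. \<open>bit ^ 'n\<close> with \<open>CARD('n) = n\<close>.\<close>

type_synonym z4 = 4

lemma module_vec: "module ((*s) :: 'a::comm_ring_1 \<Rightarrow> 'a ^ 'n \<Rightarrow> 'a ^ 'n)"
  by unfold_locales (simp_all add: vec_eq_iff algebra_simps)

definition code :: "('a::comm_ring_1 ^ 'n) set \<Rightarrow> bool" where
  "code C \<longleftrightarrow> module.subspace (*s) C"

definition dual :: "('a::comm_ring_1 ^ 'n) set \<Rightarrow> ('a ^ 'n) set" where
  "dual C = {x. \<forall>y\<in>C. scalar_product x y = 0}"

definition self_dual :: "('a::comm_ring_1 ^ 'n) set \<Rightarrow> bool" where
  "self_dual C \<longleftrightarrow> code C \<and> C = dual C"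


definition num_comp :: "'a \<Rightarrow> 'a ^ 'n \<Rightarrow> nat" where
  "num_comp a x = card {j. x $ j = a}"

definition lee_weight :: "z4 ^ 'n \<Rightarrow> nat" where
  "lee_weight x = num_comp 1 x + 2 * num_comp 2 x + num_comp 3 x"

text \<open>The minima below are only meaningful for sets containing a non-zero vector.\<close>

definition min_lee_weight :: "(z4 ^ 'n) set \<Rightarrow> nat" where
  "min_lee_weight C = Min (lee_weight ` (C - {0}))"

text \<open>\<^const>\<open>Rep_bit0\<close> yields the representative in \<open>{0, 1, 2, 3}\<close>, and
  \<^const>\<open>of_int\<close> reduces it modulo 2.\<close>

definition z4_mod2 :: "z4 \<Rightarrow> bit" where
  "z4_mod2 a = of_int (Rep_bit0 a)"

lemma z4_mod2_simps [simp]: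
  "z4_mod2 0 = 0" "z4_mod2 1 = 1" "z4_mod2 2 = 0" "z4_mod2 3 = 1"
  by (simp_all add: z4_mod2_def bit0.Rep_0 bit0.Rep_1 bit0.Rep_numeral)

definition residue_code :: "(z4 ^ 'n) set \<Rightarrow> (bit ^ 'n) set" where
  "residue_code C = (\<lambda>c. \<chi> j. z4_mod2 (c $ j)) ` C"


definition weight :: "bit ^ 'n \<Rightarrow> nat" where
  "weight x = card {j. x $ j \<noteq> 0}"

definition min_weight :: "(bit ^ 'n) set \<Rightarrow> nat" where
  "min_weight C = Min (weight ` (C - {0}))"

definition singly_even :: "(bit ^ 'n) set \<Rightarrow> bool" where
  "singly_even C \<longleftrightarrow> self_dual C \<and> (\<exists>c\<in>C. weight c mod 4 = 2)"

definition doubly_even_subcode :: "(bit ^ 'n) set \<Rightarrow> (bit ^ 'n) set" where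
  "doubly_even_subcode C = {c \<in> C. weight c mod 4 = 0}"

definition shadow :: "(bit ^ 'n) set \<Rightarrow> (bit ^ 'n) set" where
  "shadow C = dual (doubly_even_subcode C) - C"

text \<open>The shadow of a code never contains 0, so \<open>min_weight (shadow C)\<close> is the minimum over
  the whole shadow.\<close>

definition s_extremal :: "(bit ^ 'n) set \<Rightarrow> bool" where
  "s_extremal C \<longleftrightarrow> singly_even C \<and>
     real (min_weight (shadow C)) =
       (if CARD('n) mod 24 = 22 \<and> min_weight C = 4 * (CARD('n) div 24) + 6
        then real CARD('n) / 2 + 8 - 2 * real (min_weight C)
        else real CARD('n) / 2 + 4 - 2 * real (min_weight C))"

end

theory Submission
  imports Defs "HOL-Computational_Algebra.Polynomial_FPS"
begin

text \<open>
  Put \<open>n = 2m\<close>. Codewords of the residue code have weight divisible by 4, so the residue code lies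
  in the doubly even subcode \<open>C\<^sub>0\<close> of \<open>C\<close>. Hence \<open>2v \<in> \<C>\<close> for every \<open>v\<close> in the dual of \<open>C\<^sub>0\<close>,
  which contains both \<open>C\<close> and its shadow \<open>S\<close>, and all nonzero such \<open>v\<close> have weight at least
  \<open>4k + \<beta>/2\<close>.

  By Gleason's theorem the weight enumerator of \<open>C\<close> is the sum over \<open>j\<close> of
  \<open>a\<^sub>j (1 + y\<^sup>2)\<^bsup>m-4j\<^esup> (y\<^sup>2 (1 - y\<^sup>2)\<^sup>2)\<^bsup>j\<^esup>\<close>, and up to nonzero constants that of \<open>S\<close> is the sum of
  \<open>a\<^sub>j y\<^bsup>m-4j\<^esup> (1 - y\<^sup>4)\<^bsup>2j\<^esup>\<close>. So \<open>d(S) = m - 4J\<close> with \<open>J\<close> the last index such that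
  \<open>a\<^sub>J \<noteq> 0\<close>, and the bound on \<open>d(S)\<close> gives \<open>J \<le> 2k\<close>. On the other hand Lagrange inversion computes
  \<open>a\<^sub>j\<close> for \<open>2j < d(C)\<close>, and shows that \<open>a\<^bsub>2k\<^esub> \<noteq> 0\<close> and, if \<open>C\<close> had no word of weight \<open>4k + 2\<close>,
  also \<open>a\<^bsub>2k+1\<^esub> \<noteq> 0\<close>. Therefore \<open>J = 2k\<close> and \<open>d(C) = 4k + 2\<close>.
\<close>

section \<open>Gleason's theorem\<close>

text \<open>This is \<open>P(1 + y, 1 - y)\<close> for the form \<open>P(x, z) = x^N p(z/x)\<close>,
  the MacWilliams substitution with one variable set to 1. \<open>N\<close> is a formal degree and
  may exceed \<open>degree p\<close>.\<close>

definition cayley :: "nat \<Rightarrow> 'a::field poly \<Rightarrow> 'a poly" where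
  "cayley N p = (\<Sum>i\<le>N. smult (coeff p i) ([:1, 1:] ^ (N - i) * [:1, -1:] ^ i))"

lemma poly_sum_atMost:
  fixes p :: "'a::comm_semiring_1 poly"
  assumes "degree p \<le> N"
  shows "poly p x = (\<Sum>i\<le>N. coeff p i * x ^ i)"
proof -
  have "(\<Sum>i\<le>N. coeff p i * x ^ i) = (\<Sum>i\<le>degree p. coeff p i * x ^ i)"
    using assms by (intro sum.mono_neutral_right) (auto simp: coeff_eq_0)
  then show ?thesis by (simp add: poly_altdef)
qed

lemma poly_cayley:
  assumes "degree p \<le> N" "y \<noteq> -1"
  shows "poly (cayley N p) y = (1 + y) ^ N * poly p ((1 - y) / (1 + y))"
proof -
  have [simp]: "1 + y \<noteq> 0" using assms(2) by (metis add_eq_0_iff minus_minus)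
  have "(1 + y) ^ (N - i) * (1 - y) ^ i = (1 + y) ^ N * ((1 - y) / (1 + y)) ^ i" if "i \<le> N" for i
  proof -
    have "(1 + y) ^ N = (1 + y) ^ (N - i) * (1 + y) ^ i" using that by (simp flip: power_add)
    then show ?thesis by (simp add: power_divide)
  qed
  then show ?thesis
    unfolding cayley_def poly_sum_atMost[OF assms(1)] sum_distrib_left poly_sum
    by (intro sum.cong) (auto simp: poly_power)
qed

text \<open>Otherwise the difference would have infinitely many roots. The omitted point is usually
  \<open>-1\<close>, the pole in \<open>poly_cayley\<close>.\<close>

lemma poly_eqI_but_one:
  fixes p q :: "'a::field_char_0 poly"
  assumes "\<And>y. y \<noteq> c \<Longrightarrow> poly p y = poly q y"
  shows "p = q"
proof (rule ccontr)
  assume "p \<noteq> q"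
  then have "finite {y. poly (p - q) y = 0}" by (intro poly_roots_finite) simp
  moreover have "- {c} \<subseteq> {y. poly (p - q) y = 0}" using assms by auto
  ultimately have "finite (- {c})" by (rule rev_finite_subset)
  then show False by (simp add: finite_compl infinite_UNIV_char_0)
qed

lemma cayley_mult:
  fixes p q :: "'a::field_char_0 poly"
  assumes "degree p \<le> M" "degree q \<le> N"
  shows "cayley (M + N) (p * q) = cayley M p * cayley N q"
proof (rule poly_eqI_but_one[of "-1"])
  fix y :: 'a assume y: "y \<noteq> -1"
  have "degree (p * q) \<le> M + N"
    using degree_mult_le[of p q] assms by linarith
  then show "poly (cayley (M + N) (p * q)) y = poly (cayley M p * cayley N q) y"
    using assms y by (simp add: poly_cayley power_add)
qed

lemma cayley_smult: "cayley N (smult c p) = smult c (cayley N p)"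
  by (simp add: cayley_def poly_eq_iff coeff_sum sum_distrib_left mult.assoc)

lemma cayley_diff: "cayley N (p - q) = cayley N p - cayley N q"
  by (simp add: cayley_def smult_diff_left sum_subtractf)

lemma cayley_power:
  fixes p :: "'a::field_char_0 poly"
  assumes "degree p \<le> M"
  shows "cayley (M * r) (p ^ r) = cayley M p ^ r"
proof (induction r)
  case 0 show ?case by (simp add: cayley_def)
next
  case (Suc r)
  have "degree (p ^ r) \<le> M * r"
    using degree_power_le[of p r] assms by (metis le_trans mult_le_mono1)
  from cayley_mult[OF assms this] Suc show ?case by simp
qed

lemma poly_cayley_0: 
  assumes "degree p \<le> N" shows "poly (cayley N p) 0 = poly p 1"
  by (simp add: cayley_def poly_sum_atMost[OF assms] poly_sum poly_power)

lemma poly_cayley_minus_1: "poly (cayley N p) (-1) = 2 ^ N * coeff p N"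
proof -
  have "poly (cayley N p) (-1) = (\<Sum>i\<le>N. coeff p i * (0 ^ (N - i) * 2 ^ i))"
    by (simp add: cayley_def poly_sum poly_power)
  also have "\<dots> = (\<Sum>i\<le>N. if i = N then coeff p N * 2 ^ N else 0)"
    by (intro sum.cong) (auto simp: power_0_left)
  finally show ?thesis by simp
qed

text \<open>Gleason's second generator \<open>x^2 y^2 (x^2 - y^2)^2\<close> at \<open>x = 1\<close>.
  It has degree 6 but is used with formal degree 8.\<close>

definition gleason8 :: "'a::field poly" where
  "gleason8 = [:0, 1:] ^ 2 * [:1, 0, -1:] ^ 2"

lemma degree_gleason8: "degree gleason8 \<le> 8"
  unfolding gleason8_def
  by (rule order.trans[OF degree_mult_le] order.trans[OF add_mono[OF degree_power_le degree_power_le]])+ simp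

lemma poly_gleason8: "poly gleason8 y = y ^ 2 * (1 - y ^ 2) ^ 2"
  by (simp add: gleason8_def poly_power power2_eq_square[of y])

text \<open>With \<open>w = (1 - y) / (1 + y)\<close> one has
  \<open>1 - w^2 = 4y / (1 + y)^2\<close>, so the factors \<open>w^2\<close> and
  \<open>(1 - w^2)^2\<close> trade roles and a factor \<open>4^2\<close> appears.\<close>

lemma cayley_gleason8: "cayley 8 gleason8 = smult 16 (gleason8 :: 'a::field_char_0 poly)"
proof (rule poly_eqI_but_one[of "-1"])
  fix y :: 'a assume y: "y \<noteq> -1"
  then have [simp]: "1 + y \<noteq> 0" by (metis add_eq_0_iff minus_minus)
  define w where "w = (1 - y) / (1 + y)"
  have w: "w * (1 + y) = 1 - y" by (simp add: w_def)
  have "(1 + y) ^ 8 * (w ^ 2 * (1 - w ^ 2) ^ 2)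
      = (w * (1 + y)) ^ 2 * ((1 + y) ^ 2 - (w * (1 + y)) ^ 2) ^ 2 * (1 + y) ^ 2"
    by algebra
  also have "\<dots> = 16 * (y ^ 2 * (1 - y ^ 2) ^ 2)"
    unfolding w by algebra
  finally show "poly (cayley 8 gleason8) y = poly (smult 16 gleason8) y"
    by (simp add: poly_cayley[OF degree_gleason8 y] poly_gleason8 w_def)
qed

text \<open>An instance of \<open>(1 - x)^2 + (2 - x) x = 1\<close>: because of this coprimality, if
  \<open>(1 - x)^2\<close> divides \<open>x f\<close> then it divides \<open>f\<close>.\<close>

lemma bezout_one_minus:
  fixes x f :: "'a::comm_ring_1"
  shows "(1 - x) ^ 2 * f + (2 - x) * (x * f) = f"
  by (simp add: algebra_simps power2_eq_square)

text \<open>Induction on \<open>m\<close>: subtracting a multiple of \<open>(1 + y^2)^m\<close>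
  removes the constant term; invariance and evenness then force divisibility by
  \<open>gleason8\<close>, and the quotient satisfies the same hypotheses for
  \<open>m - 4\<close>.\<close>

theorem gleason:
  fixes p :: "'a::field_char_0 poly"
  assumes "degree p \<le> 2 * m" "\<And>y. poly p (- y) = poly p y" "cayley (2 * m) p = smult (2 ^ m) p"
  shows "\<exists>a. p = (\<Sum>j\<le>m div 4. smult (a j) ([:1, 0, 1:] ^ (m - 4 * j) * gleason8 ^ j))"
  using assms
proof (induction m arbitrary: p rule: less_induct)
  case (less m)
  define e :: "'a poly" where "e = [:1, 0, 1:]"
  define q where "q = p - smult (poly p 0) (e ^ m)"
  have deg_e: "degree (e ^ r) \<le> 2 * r" for r
    using degree_power_le[of e r] by (simp add: e_def)
  have "cayley 2 e = smult 2 e"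
    by (simp add: e_def cayley_def numeral_2_eq_2)
  then have "cayley (2 * m) (e ^ m) = smult (2 ^ m) (e ^ m)"
    using cayley_power[of e 2 m] by (simp add: smult_power) (simp add: e_def)
  then have cay_q: "cayley (2 * m) q = smult (2 ^ m) q"
    unfolding q_def using less.prems(3)
    by (simp add: cayley_diff cayley_smult smult_diff_right mult.commute)
  have deg_q: "degree q \<le> 2 * m"
    unfolding q_def using less.prems(1) deg_e[of m]
    by (intro degree_diff_le) (auto intro: order.trans[OF degree_smult_le])
  have even_q: "poly q (- y) = poly q y" for y
    using less.prems(2) by (simp add: q_def e_def poly_power)
  have odd_coeff: "coeff q i = 0" if "odd i" for i
  proof -
    have "q = pcompose q [:0, -1:]" 
      by (rule poly_eqI_but_one[of 0]) (simp add: poly_pcompose even_q)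
    then have "coeff q i = coeff (pcompose q [:0, -1:]) i" by simp
    also have "\<dots> = - coeff q i" using that by (simp add: coeff_pcompose_linear)
    finally show ?thesis by (simp add: eq_neg_iff_add_eq_0 flip: mult_2)
  qed
  have q0: "poly q 0 = 0" by (simp add: q_def e_def poly_power)
  \<comment> \<open>The zero of \<open>q\<close> at 0 is carried to 1 by invariance, to -1 by
    evenness, and from there by invariance to the coefficient of degree
    \<open>2 * m\<close>.\<close>
  have q1: "poly q 1 = 0"
    using poly_cayley_0[OF deg_q] by (simp add: cay_q q0)
  then have "poly q (-1) = 0" using even_q[of 1] by simp
  then have top: "coeff q (2 * m) = 0"
    using poly_cayley_minus_1[of "2 * m" q] by (simp add: cay_q)
  have "coeff q i = 0" if "i < 2" for i
    using that q0 odd_coeff[of 1] by (auto simp: poly_0_coeff_0 less_2_cases_iff)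
  then obtain q' where q': "q = [:0, 1:] ^ 2 * q'"
    by (metis monom_1_dvd_iff' dvdE monom_altdef smult_1_left)
  show ?case
  proof (cases "q = 0")
    case True
    then have "p = smult (poly p 0) (e ^ m)" by (simp add: q_def)
    then have "p = (\<Sum>j\<le>m div 4. smult (if j = 0 then poly p 0 else 0) (e ^ (m - 4 * j) * gleason8 ^ j))"
      by (subst sum.remove[of _ 0]) auto
    then show ?thesis
      unfolding e_def by (rule exI[of _ "\<lambda>j. if j = 0 then poly p 0 else 0"])
  next
    case False
    then have [simp]: "q' \<noteq> 0" using q' by auto
    have dq: "degree q = degree q' + 2"
      unfolding q' by (subst degree_mult_eq) (auto simp: degree_power_eq)
    have "degree q \<noteq> 2 * m" using top False leading_coeff_0_iff by metis
    moreover have "degree q \<noteq> 2 * m - 1" if "m > 0"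
    proof -
      have "odd (2 * m - 1)" using that by simp
      then show ?thesis using odd_coeff False leading_coeff_0_iff by metis
    qed
    ultimately have m2: "degree q' \<le> 2 * m - 4" "m \<ge> 2" using dq deg_q by auto
    \<comment> \<open>The constant 1 is given formal degree 2 to account for the degree drop of
      \<open>q'\<close>. It becomes \<open>(1 + y)^2\<close>, while \<open>y^2\<close> becomes
      \<open>(1 - y)^2\<close>.\<close>
    have "cayley 2 ([:0, 1:] ^ 2 :: 'a poly) = [:1, -1:] ^ 2"
      using cayley_power[of "[:0, 1:] :: 'a poly" 1 2] by (simp add: cayley_def)
    moreover have "cayley 2 (1 :: 'a poly) = [:1, 1:] ^ 2"
      by (simp add: cayley_def numeral_2_eq_2)
    moreover have "cayley (2 + (2 + (2 * m - 4))) ([:0, 1:] ^ 2 * (1 * q'))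
      = cayley 2 ([:0, 1:] ^ 2) * (cayley 2 1 * cayley (2 * m - 4) q')"
      using m2 by (subst cayley_mult; (subst cayley_mult)?) (auto simp: degree_power_eq)
    moreover have "2 + (2 + (2 * m - 4)) = 2 * m" using m2 by simp
    ultimately have "smult (2 ^ m) q = [:1, -1:] ^ 2 * ([:1, 1:] ^ 2 * cayley (2 * m - 4) q')"
      using cay_q q' by simp
    also have "\<dots> = [:1, 0, -1:] ^ 2 * cayley (2 * m - 4) q'"
      by (simp add: mult.assoc[symmetric] flip: power_mult_distrib)
    finally have "[:1, 0, -1:] ^ 2 dvd smult (2 ^ m) q" by (metis dvd_triv_left)
    then have "[:1, 0, -1:] ^ 2 dvd q" by (simp add: dvd_smult_iff)
    then have "[:1, 0, -1:] ^ 2 dvd [:1, 0, -1:] ^ 2 * q' + (2 - [:0, 1:] ^ 2) * q"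
      by (metis dvd_add dvd_mult dvd_triv_left)
    also have "[:1, 0, -1:] ^ 2 * q' + (2 - [:0, 1:] ^ 2) * q = q'"
    proof -
      have "[:1, 0, -1 :: 'a:] = 1 - [:0, 1:] ^ 2" by (simp add: power2_eq_square one_pCons)
      then show ?thesis unfolding q' by (simp only: bezout_one_minus)
    qed
    finally obtain r where r: "q' = [:1, 0, -1:] ^ 2 * r" by blast
    have qr: "q = gleason8 * r" by (simp add: q' r gleason8_def mult.assoc)
    have [simp]: "r \<noteq> 0" "(gleason8 :: 'a poly) \<noteq> 0" using False qr by auto
    have "degree q' = degree r + 4"
      unfolding r by (subst degree_mult_eq) (auto simp: degree_power_eq)
    then have m4: "degree r \<le> 2 * (m - 4)" "m \<ge> 4" using m2 by auto
    have even_r: "poly r (- y) = poly r y" for y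
    proof -
      define r' where "r' = pcompose r [:0, -1:]"
      have "gleason8 * r' = gleason8 * r"
      proof (rule poly_eqI_but_one[of 0])
        fix y :: 'a
        show "poly (gleason8 * r') y = poly (gleason8 * r) y"
          using even_q[of y] by (simp add: qr r'_def poly_pcompose gleason8_def poly_power)
      qed
      then have "r' = r" by simp
      then show ?thesis by (metis r'_def poly_pcompose mult_minus1_right poly_pCons poly_0 add_0 mult_zero_right add.right_neutral)
    qed
    have "smult (2 ^ m) (gleason8 * r) = smult 16 gleason8 * cayley (2 * (m - 4)) r"
      using cayley_mult[OF degree_gleason8 m4(1)] cay_q m4(2) by (simp add: qr cayley_gleason8 algebra_simps)
    also have "\<dots> = gleason8 * smult 16 (cayley (2 * (m - 4)) r)" by simp
    finally have "gleason8 * smult (2 ^ m) r = gleason8 * smult 16 (cayley (2 * (m - 4)) r)" by simp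
    then have "smult (2 ^ m) r = smult 16 (cayley (2 * (m - 4)) r)"
      by (simp only: mult_left_cancel[OF \<open>gleason8 \<noteq> 0\<close>])
    moreover have "(2 :: 'a) ^ m = 16 * 2 ^ (m - 4)"
      using m4(2) power_add[of "2 :: 'a" 4 "m - 4"] by simp
    ultimately have "smult 16 (smult (2 ^ (m - 4)) r) = smult 16 (cayley (2 * (m - 4)) r)"
      by simp
    then have cay_r: "cayley (2 * (m - 4)) r = smult (2 ^ (m - 4)) r"
      by (metis smult_eq_iff zero_neq_numeral)
    obtain a where a: "r = (\<Sum>j\<le>(m - 4) div 4. smult (a j) (e ^ (m - 4 - 4 * j) * gleason8 ^ j))"
      using less.IH[OF _ m4(1) even_r cay_r] m4(2) unfolding e_def by auto
    define b where "b j = (if j = 0 then poly p 0 else a (j - 1))" for j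
    have "p = smult (poly p 0) (e ^ m) + gleason8 * r" unfolding qr[symmetric] by (simp add: q_def)
    also have "gleason8 * r = (\<Sum>j\<le>(m - 4) div 4. smult (b (Suc j)) (e ^ (m - 4 * Suc j) * gleason8 ^ Suc j))"
      by (simp add: a sum_distrib_left b_def algebra_simps)
    also have "smult (poly p 0) (e ^ m) + \<dots> = (\<Sum>j\<le>Suc ((m - 4) div 4). smult (b j) (e ^ (m - 4 * j) * gleason8 ^ j))"
      by (subst sum.atMost_Suc_shift) (simp add: b_def)
    also have "Suc ((m - 4) div 4) = m div 4" using m4(2) by simp
    finally show ?thesis unfolding e_def by blast
  qed
qed

section \<open>Lagrange inversion\<close>

text \<open>Put \<open>z = X u\<close>, so that \<open>v^J = X^J / z^J\<close>. The coefficient is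
  the residue of \<open>F' / z^J\<close>, and \<open>(z^j)' / z^J\<close> is the derivative of a
  Laurent series unless \<open>j = J\<close>. The proof replaces Laurent series by a case
  distinction on \<open>j\<close> and \<open>J\<close>.\<close>

lemma fps_lagrange_coeff:
  fixes u v :: "'a::field_char_0 fps"
  assumes uv: "u * v = 1" and F: "F = (\<Sum>j\<le>K. fps_const (a j) * (fps_X * u) ^ j)"
    and a: "\<And>j. K < j \<Longrightarrow> a j = 0" and J: "0 < J"
  shows "fps_nth (v ^ J * fps_deriv F) (J - 1) = of_nat J * a J"
proof -
  have inv_deriv: "fps_deriv u * v ^ 2 = - fps_deriv v"
  proof -
    have "fps_deriv (u * v) = 0" by (simp add: uv)
    then have "fps_deriv u * v + u * fps_deriv v = 0" by (simp add: add.commute)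
    then have "(fps_deriv u * v + u * fps_deriv v) * v = 0" by simp
    then have "fps_deriv u * v ^ 2 + (u * v) * fps_deriv v = 0"
      by (simp add: algebra_simps power2_eq_square)
    then show ?thesis by (simp add: uv eq_neg_iff_add_eq_0)
  qed
  have term_nth: "fps_nth (v ^ J * fps_deriv ((fps_X * u) ^ j)) (J - 1) = (if j = J then of_nat J else 0)" for j
  proof (cases j)
    case 0
    then show ?thesis using J by simp
  next
    case (Suc i)
    have eq: "v ^ J * fps_deriv ((fps_X * u) ^ j)
        = of_nat j * (fps_X ^ i * (u ^ i * v ^ J * (u + fps_X * fps_deriv u)))"
    proof -
      have "fps_deriv ((fps_X * u) ^ j) = of_nat j * (u + fps_X * fps_deriv u) * (fps_X * u) ^ i"
        by (simp add: Suc fps_deriv_power' add.commute del: power_Suc)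
      then show ?thesis by (simp only: power_mult_distrib mult_ac)
    qed
    show ?thesis
    proof (cases "j \<le> J")
      case False
      then have "J - 1 < i" "j \<noteq> J" using Suc J by auto
      then show ?thesis unfolding eq by (simp add: fps_X_power_mult_nth flip: fps_of_nat)
    next
      case True
      define N where "N = J - j"
      have JN: "J = Suc i + N" using True Suc by (simp add: N_def)
      have "u ^ i * v ^ J * (u + fps_X * fps_deriv u)
          = (u * v) ^ i * ((u * v) * v ^ N + fps_X * (fps_deriv u * v ^ (N + 1)))"
        unfolding JN by (simp add: power_add power_mult_distrib algebra_simps)
      then have eq2: "u ^ i * v ^ J * (u + fps_X * fps_deriv u) = v ^ N + fps_X * (fps_deriv u * v ^ (N + 1))"
        by (simp add: uv)
      have nth: "fps_nth (v ^ J * fps_deriv ((fps_X * u) ^ j)) (J - 1)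
          = of_nat j * fps_nth (v ^ N + fps_X * (fps_deriv u * v ^ (N + 1))) N"
        unfolding eq eq2 using JN by (simp add: fps_X_power_mult_nth flip: fps_of_nat)
      show ?thesis
      proof (cases N)
        case 0
        then show ?thesis unfolding nth using JN Suc by simp
      next
        case (Suc M)
        have "fps_deriv (v ^ N) = - of_nat N * (fps_deriv u * v ^ (N + 1))"
        proof -
          have "fps_deriv (v ^ N) = of_nat N * v ^ M * fps_deriv v"
            by (simp add: Suc fps_deriv_power' mult_ac del: power_Suc of_nat_Suc)
          also have "fps_deriv v = - (fps_deriv u * v ^ 2)" by (simp add: inv_deriv)
          also have "of_nat N * v ^ M * - (fps_deriv u * v ^ 2) = - of_nat N * (fps_deriv u * v ^ (N + 1))"
            by (simp add: Suc power2_eq_square algebra_simps)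
          finally show ?thesis .
        qed
        \<comment> \<open>For any series \<open>g\<close>, the coefficient of \<open>X^N\<close> in
          \<open>N g - X g'\<close> is zero; here \<open>g = v^N\<close>.\<close>
        then have "of_nat N * (v ^ N + fps_X * (fps_deriv u * v ^ (N + 1)))
            = of_nat N * v ^ N - fps_X * fps_deriv (v ^ N)"
          by (simp add: algebra_simps)
        then have "fps_nth (of_nat N * (v ^ N + fps_X * (fps_deriv u * v ^ (N + 1)))) N
            = fps_nth (of_nat N * v ^ N - fps_X * fps_deriv (v ^ N)) N" by (rule arg_cong)
        also have "\<dots> = 0"
        proof -
          have "fps_nth (of_nat N * g - fps_X * fps_deriv g) N = 0" for g :: "'a fps"
            by (simp add: Suc flip: fps_of_nat)
          then show ?thesis .
        qed
        finally have "of_nat N * fps_nth (v ^ N + fps_X * (fps_deriv u * v ^ (N + 1))) N = (0 :: 'a)"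
          by (simp flip: fps_of_nat)
        then have "fps_nth (v ^ N + fps_X * (fps_deriv u * v ^ (N + 1))) N = 0"
          using Suc by (simp del: fps_add_nth of_nat_Suc)
        then show ?thesis unfolding nth using JN Suc \<open>j = Suc i\<close> by simp
      qed
    qed
  qed
  have "v ^ J * fps_deriv F = (\<Sum>j\<le>K. fps_const (a j) * (v ^ J * fps_deriv ((fps_X * u) ^ j)))"
    unfolding F by (simp only: fps_deriv_sum fps_deriv_mult_const_left sum_distrib_left mult.left_commute)
  then have "fps_nth (v ^ J * fps_deriv F) (J - 1) = (\<Sum>j\<le>K. a j * (if j = J then of_nat J else 0))"
    by (simp only: fps_sum_nth fps_mult_left_const_nth term_nth)
  also have "\<dots> = (\<Sum>j\<le>K. if j = J then a J * of_nat J else 0)"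
    by (intro sum.cong) auto
  also have "\<dots> = of_nat J * a J" using a[of J] by (auto simp: not_le mult.commute)
  finally show ?thesis .
qed

text \<open>The expansion is in powers of \<open>z = X (1 - X)\<^sup>2 / (1 + X)\<^sup>4\<close>, after division by \<open>(1 + X) ^ m\<close>.\<close>

lemma fps_expansion_coeff:
  fixes a :: "nat \<Rightarrow> 'a::field_char_0"
  assumes F: "(\<Sum>j\<le>m div 4. fps_const (a j) * ((1 + fps_X) ^ (m - 4 * j) * (fps_X * (1 - fps_X) ^ 2) ^ j))
      = 1 + fps_X ^ L * R"
    and a: "\<And>j. m div 4 < j \<Longrightarrow> a j = 0" and J: "0 < J" "J < L"
  shows "of_nat J * a J = - of_nat m *
    fps_nth ((1 + fps_X) ^ (4 * J) * inverse (1 + fps_X) ^ (m + 1) * inverse (1 - fps_X) ^ (2 * J)) (J - 1)"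
proof -
  define x where "x = (1 + fps_X :: 'a fps)"
  define z where "z = (1 - fps_X :: 'a fps)"
  define w where "w = inverse x"
  define t where "t = inverse z"
  define G where "G = (\<Sum>j\<le>m div 4. fps_const (a j) * (fps_X * (z ^ 2 * w ^ 4)) ^ j)"
  have xw: "x * w = 1" unfolding w_def by (rule inverse_mult_eq_1') (simp add: x_def)
  have zt: "z * t = 1" unfolding t_def by (rule inverse_mult_eq_1') (simp add: z_def)
  have uv: "(z ^ 2 * w ^ 4) * (x ^ 4 * t ^ 2) = 1"
  proof -
    have "(z ^ 2 * w ^ 4) * (x ^ 4 * t ^ 2) = (x * w) ^ 4 * (z * t) ^ 2"
      by (simp add: power_mult_distrib algebra_simps)
    then show ?thesis by (simp add: xw zt)
  qed
  have G_eq: "G = w ^ m * (1 + fps_X ^ L * R)"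
  proof -
    have "w ^ m * (x ^ (m - 4 * j) * (fps_X * z ^ 2) ^ j) = (fps_X * (z ^ 2 * w ^ 4)) ^ j" if "j \<le> m div 4" for j
    proof -
      have "w ^ m = w ^ (m - 4 * j) * w ^ (4 * j)" using that by (simp flip: power_add)
      then have "w ^ m * (x ^ (m - 4 * j) * (fps_X * z ^ 2) ^ j)
          = (x * w) ^ (m - 4 * j) * (w ^ (4 * j) * (fps_X * z ^ 2) ^ j)"
        by (simp only: power_mult_distrib mult_ac)
      also have "\<dots> = (fps_X * (z ^ 2 * w ^ 4)) ^ j"
        by (simp only: xw power_one mult_1_left)
          (simp only: power_mult[symmetric] power_mult_distrib mult_ac)
      finally show ?thesis .
    qed
    then show ?thesis
      unfolding G_def F[symmetric] x_def[symmetric] z_def[symmetric] sum_distrib_left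
      by (intro sum.cong) (simp_all add: mult.left_commute)
  qed
  have dw: "fps_deriv w = - (w ^ 2)"
    unfolding w_def by (subst fps_inverse_deriv) (simp_all add: x_def)
  \<comment> \<open>Everything coming from \<open>R\<close> carries a factor
    \<open>X^(L - 1)\<close> and is invisible in degree \<open>J - 1\<close>.\<close>
  have dG: "fps_deriv G = - of_nat m * w ^ (m + 1)
      + fps_X ^ (L - 1) * (of_nat L * w ^ m * R + fps_X * (fps_deriv (w ^ m) * R + w ^ m * fps_deriv R))"
  proof -
    have dwm: "fps_deriv (w ^ m) = - of_nat m * w ^ (m + 1)"
      unfolding fps_deriv_power' dw by (cases m) (simp_all add: power2_eq_square mult_ac del: of_nat_Suc)
    have dX: "fps_deriv (fps_X ^ L) = of_nat L * (fps_X ^ (L - 1) :: 'a fps)"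
      by (simp add: fps_deriv_power algebra_simps fps_of_nat)
    have XL: "fps_X ^ L = fps_X ^ (L - 1) * (fps_X :: 'a fps)"
      using J by (simp flip: power_Suc2)
    have "fps_deriv G = fps_deriv (w ^ m) + (fps_deriv (w ^ m) * R + w ^ m * fps_deriv R) * fps_X ^ L
        + w ^ m * R * fps_deriv (fps_X ^ L)"
      by (simp add: G_eq algebra_simps)
    then show ?thesis unfolding dX dwm unfolding XL by (simp add: algebra_simps)
  qed
  have "of_nat J * a J = fps_nth ((x ^ 4 * t ^ 2) ^ J * fps_deriv G) (J - 1)"
    using fps_lagrange_coeff[OF uv G_def a J(1)] by simp
  also have "\<dots> = fps_nth (- of_nat m * ((x ^ 4 * t ^ 2) ^ J * w ^ (m + 1))
     + fps_X ^ (L - 1) * ((x ^ 4 * t ^ 2) ^ J * (of_nat L * w ^ m * R + fps_X * (fps_deriv (w ^ m) * R + w ^ m * fps_deriv R)))) (J - 1)"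
    unfolding dG by (simp only: algebra_simps)
  also have "\<dots> = fps_nth (- of_nat m * ((x ^ 4 * t ^ 2) ^ J * w ^ (m + 1))) (J - 1)"
    using J by (simp only: fps_add_nth fps_X_power_mult_nth) simp
  also have "(x ^ 4 * t ^ 2) ^ J * w ^ (m + 1) = x ^ (4 * J) * w ^ (m + 1) * t ^ (2 * J)"
    by (simp only: power_mult[symmetric] power_mult_distrib mult_ac)
  finally show ?thesis
    unfolding w_def t_def by (simp add: x_def z_def flip: fps_of_nat)
qed

section \<open>Sign patterns of power series and nonvanishing of Gleason coefficients\<close>

text \<open>Because \<open>s\<close> is fixed, this sign pattern survives multiplication, so no cancellation occurs.\<close>

definition signed_pos :: "'a::comm_ring_1 \<Rightarrow> nat set \<Rightarrow> 'a fps \<Rightarrow> bool" where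
  "signed_pos s A f \<longleftrightarrow> (\<exists>c. (\<forall>i. fps_nth f i = s ^ i * of_nat (c i)) \<and> (\<forall>i\<in>A. 0 < c i))"

lemma signed_pos_mult:
  assumes "signed_pos s A f" "signed_pos s B g" "\<And>i. i \<in> D \<Longrightarrow> \<exists>j\<le>i. j \<in> A \<and> i - j \<in> B"
  shows "signed_pos s D (f * g)"
proof -
  from assms(1) obtain c where c: "\<And>i. fps_nth f i = s ^ i * of_nat (c i)" "\<And>i. i \<in> A \<Longrightarrow> 0 < c i"
    by (auto simp: signed_pos_def)
  from assms(2) obtain d where d: "\<And>i. fps_nth g i = s ^ i * of_nat (d i)" "\<And>i. i \<in> B \<Longrightarrow> 0 < d i"
    by (auto simp: signed_pos_def)
  have "fps_nth (f * g) i = s ^ i * of_nat (\<Sum>j=0..i. c j * d (i - j))" for i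
  proof -
    have "fps_nth (f * g) i = (\<Sum>j=0..i. s ^ j * of_nat (c j) * (s ^ (i - j) * of_nat (d (i - j))))"
      by (simp add: fps_mult_nth c d)
    also have "\<dots> = (\<Sum>j=0..i. s ^ i * (of_nat (c j) * of_nat (d (i - j))))"
    proof (intro sum.cong refl)
      fix j assume "j \<in> {0..i}"
      then have "s ^ i = s ^ j * s ^ (i - j)" by (simp flip: power_add)
      then show "s ^ j * of_nat (c j) * (s ^ (i - j) * of_nat (d (i - j))) = s ^ i * (of_nat (c j) * of_nat (d (i - j)))"
        by (simp add: algebra_simps)
    qed
    finally show ?thesis by (simp add: sum_distrib_left)
  qed
  moreover have "0 < (\<Sum>j=0..i. c j * d (i - j))" if i: "i \<in> D" for i
  proof -
    obtain j where "j \<le> i" "j \<in> A" "i - j \<in> B" using assms(3)[OF i] by blast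
    then show ?thesis using c(2)[of j] d(2)[of "i - j"] by (intro sum_pos2[of _ j]) auto
  qed
  ultimately show ?thesis
    unfolding signed_pos_def by (intro exI[of _ "\<lambda>i. \<Sum>j=0..i. c j * d (i - j)"]) blast
qed

text \<open>The base is \<open>1 / (1 - X^2)\<close>, with coefficient 1 at even exponents only,
  where \<open>s^i = 1\<close>. Hence it fits both signs, \<open>s = 1\<close> and
  \<open>s = -1\<close>.\<close>

lemma signed_pos_inverse_power:
  fixes s :: "'a::field_char_0"
  assumes s: "s ^ 2 = 1" and N: "0 < N"
  shows "signed_pos s {i. even i} ((inverse (1 + fps_X) * inverse (1 - fps_X)) ^ N)"
proof -
  define f where "f = (inverse (1 + fps_X) * inverse (1 - fps_X) :: 'a fps)"
  define g where "g = Abs_fps (\<lambda>i. if even i then 1 else 0 :: 'a)"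
  have "(1 - fps_X ^ 2) * g = 1"
  proof (rule fps_ext)
    fix i
    have "fps_nth ((1 - fps_X ^ 2) * g) i = fps_nth g i - (if i < 2 then 0 else fps_nth g (i - 2))"
      by (simp add: left_diff_distrib fps_X_power_mult_nth)
    then show "fps_nth ((1 - fps_X ^ 2) * g) i = fps_nth 1 i"
      by (cases "i < 2") (auto simp: g_def less_2_cases_iff)
  qed
  moreover have "(1 - fps_X ^ 2) = (1 + fps_X :: 'a fps) * (1 - fps_X)"
    by (simp add: algebra_simps power2_eq_square)
  ultimately have g: "(1 + fps_X) * (1 - fps_X) * g = 1" by simp
  have inv: "inverse (1 + fps_X) * (1 + fps_X) = (1 :: 'a fps)"
    "inverse (1 - fps_X) * (1 - fps_X) = (1 :: 'a fps)" by (simp_all add: inverse_mult_eq_1)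
  have "f = f * ((1 + fps_X) * (1 - fps_X) * g)" by (simp add: g)
  also have "\<dots> = (inverse (1 + fps_X) * (1 + fps_X)) * (inverse (1 - fps_X) * (1 - fps_X)) * g"
    unfolding f_def by (simp only: mult_ac)
  finally have f_g: "f = g" by (simp only: inv mult_1)
  have base: "signed_pos s {i. even i} f"
  proof -
    have "s ^ i = 1" if "even i" for i
      using that s by (metis dvd_def power_mult power_one)
    then show ?thesis unfolding signed_pos_def f_g g_def
      by (intro exI[of _ "\<lambda>i. if even i then 1 else 0"]) simp
  qed
  from N have "signed_pos s {i. even i} (f ^ N)"
  proof (induction N rule: nat_induct_non_zero)
    case (Suc N)
    then show ?case unfolding power_Suc by (intro signed_pos_mult[OF base]) auto
  qed (simp add: base)
  then show ?thesis by (simp add: f_def)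
qed

lemma signed_pos_linear_power:
  fixes s :: "'a::comm_ring_1"
  shows "signed_pos s {0..e} ((1 + fps_const s * fps_X) ^ e)"
proof (induction e)
  case 0
  show ?case unfolding signed_pos_def by (intro exI[of _ "\<lambda>i. if i = 0 then 1 else 0"]) auto
next
  case (Suc e)
  have "signed_pos s {0, 1} (1 + fps_const s * fps_X)"
    unfolding signed_pos_def by (intro exI[of _ "\<lambda>i. if i \<le> 1 then 1 else 0"]) (auto simp: fps_X_def)
  then show ?case unfolding power_Suc
  proof (rule signed_pos_mult[OF _ Suc])
    fix i assume "i \<in> {0..Suc e}"
    then show "\<exists>j\<le>i. j \<in> {0, 1} \<and> i - j \<in> {0..e}"
      by (intro exI[of _ "if i = 0 then 0 else 1"]) auto
  qed
qed

lemma signed_pos_nonzero: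
  fixes f :: "'a::field_char_0 fps"
  assumes "signed_pos s A f" "s \<noteq> 0" "i \<in> A"
  shows "fps_nth f i \<noteq> 0"
  using assms by (force simp: signed_pos_def)

text \<open>For \<open>J = 2k\<close> the Lagrange series equals
  \<open>(1 - X^2)^-(4k+h+1) (1 - X)^(h+1)\<close>. With \<open>s = -1\<close> all its odd
  coefficients are nonzero, and \<open>2k - 1\<close> is odd.\<close>

lemma expansion_coeff_even:
  fixes a :: "nat \<Rightarrow> 'a::field_char_0"
  assumes F: "(\<Sum>j\<le>m div 4. fps_const (a j) * ((1 + fps_X) ^ (m - 4 * j) * (fps_X * (1 - fps_X) ^ 2) ^ j))
      = 1 + fps_X ^ L * R"
    and a: "\<And>j. m div 4 < j \<Longrightarrow> a j = 0" and L: "2 * k < L" and m: "m = 12 * k + h" "0 < m"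
  shows "a (2 * k) \<noteq> 0"
\<comment> \<open>Lagrange inversion requires a positive index; \<open>a 0\<close> is read off as
  the constant term.\<close>
proof (cases "k = 0")
  case True
  have "fps_nth (\<Sum>j\<le>m div 4. fps_const (a j) * ((1 + fps_X) ^ (m - 4 * j) * (fps_X * (1 - fps_X) ^ 2) ^ j)) 0
    = (\<Sum>j\<le>m div 4. if j = 0 then a 0 else 0)"
    unfolding fps_sum_nth by (intro sum.cong) (auto simp: fps_power_zeroth power_0_left)
  then show ?thesis using True L by (simp add: F)
next
  case False
  define x where "x = (1 + fps_X :: 'a fps)"
  define z where "z = (1 - fps_X :: 'a fps)"
  define w where "w = inverse x"
  define t where "t = inverse z"
  have xw: "x * w = 1" unfolding w_def by (rule inverse_mult_eq_1') (simp add: x_def)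
  have zt: "z * t = 1" unfolding t_def by (rule inverse_mult_eq_1') (simp add: z_def)
  have "w ^ (m + 1) = w ^ (8 * k) * w ^ (4 * k + h + 1)" by (simp add: m(1) flip: power_add)
  \<comment> \<open>Inserting \<open>(z t)^(h+1) = 1\<close> brings the exponents of
    \<open>w\<close> and \<open>t\<close> to the same value.\<close>
  then have "x ^ (8 * k) * w ^ (m + 1) * t ^ (4 * k)
      = x ^ (8 * k) * (w ^ (8 * k) * w ^ (4 * k + h + 1)) * t ^ (4 * k) * (z * t) ^ (h + 1)"
    by (simp only: zt power_one mult_1_right)
  also have "\<dots> = (x * w) ^ (8 * k) * w ^ (4 * k + h + 1) * (t ^ (4 * k) * t ^ (h + 1)) * z ^ (h + 1)"
    by (simp only: power_mult_distrib mult_ac)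
  also have "t ^ (4 * k) * t ^ (h + 1) = t ^ (4 * k + h + 1)" by (simp flip: power_add)
  also have "(x * w) ^ (8 * k) * w ^ (4 * k + h + 1) * t ^ (4 * k + h + 1) * z ^ (h + 1)
      = (w * t) ^ (4 * k + h + 1) * z ^ (h + 1)"
    by (simp only: xw power_one mult_1_left) (simp only: power_mult_distrib mult_ac)
  finally have eq: "x ^ (8 * k) * w ^ (m + 1) * t ^ (4 * k) = (w * t) ^ (4 * k + h + 1) * z ^ (h + 1)" .
  have "signed_pos (-1) {i. odd i} ((w * t) ^ (4 * k + h + 1) * z ^ (h + 1))"
  proof (rule signed_pos_mult)
    show "signed_pos (-1) {i. even i} ((w * t) ^ (4 * k + h + 1))"
      unfolding w_def t_def x_def z_def by (rule signed_pos_inverse_power) auto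
    have "z = 1 + fps_const (-1) * fps_X" by (simp add: z_def flip: fps_const_neg)
    then show "signed_pos (-1) {0..h + 1} (z ^ (h + 1))" using signed_pos_linear_power by metis
    fix i :: nat assume "i \<in> {i. odd i}"
    then show "\<exists>j\<le>i. j \<in> {i. even i} \<and> i - j \<in> {0..h + 1}"
      \<comment> \<open>An even exponent \<open>i - 1\<close> from the first factor and exponent 1
        from \<open>(1 - X)^(h+1)\<close>.\<close>
      by (intro exI[of _ "i - 1"]) (auto elim: oddE)
  qed
  then have "fps_nth (x ^ (8 * k) * w ^ (m + 1) * t ^ (4 * k)) (2 * k - 1) \<noteq> 0"
    unfolding eq using False by (intro signed_pos_nonzero) auto
  moreover have "of_nat (2 * k) * a (2 * k)
      = - of_nat m * fps_nth (x ^ (8 * k) * w ^ (m + 1) * t ^ (4 * k)) (2 * k - 1)"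
    using fps_expansion_coeff[OF F a, of "2 * k"] False L by (simp add: w_def t_def x_def z_def)
  ultimately show ?thesis using m(2) by auto
qed

text \<open>For \<open>J = 2k + 1\<close> the Lagrange series equals
  \<open>(1 - X^2)^-(4k+2) (1 + X)^(5-h)\<close>, where \<open>h \<le> 5\<close> makes the last
  exponent nonnegative. With \<open>s = 1\<close> all even coefficients are nonzero, in particular
  the one at \<open>2k\<close>.\<close>

lemma expansion_coeff_odd:
  fixes a :: "nat \<Rightarrow> 'a::field_char_0"
  assumes F: "(\<Sum>j\<le>m div 4. fps_const (a j) * ((1 + fps_X) ^ (m - 4 * j) * (fps_X * (1 - fps_X) ^ 2) ^ j))
      = 1 + fps_X ^ L * R"
    and a: "\<And>j. m div 4 < j \<Longrightarrow> a j = 0" and L: "2 * k + 1 < L" and m: "m = 12 * k + h" "0 < m" "h \<le> 5"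
  shows "a (2 * k + 1) \<noteq> 0"
proof -
  define x where "x = (1 + fps_X :: 'a fps)"
  define w where "w = inverse x"
  define t where "t = inverse (1 - fps_X :: 'a fps)"
  have xw: "x * w = 1" unfolding w_def by (rule inverse_mult_eq_1') (simp add: x_def)
  have "x ^ (8 * k + 4) * w ^ (m + 1) = x ^ (8 * k + 4) * w ^ (m + 1) * (x * w) ^ (5 - h)"
    by (simp add: xw)
  also have "\<dots> = x ^ (8 * k + 4) * (w ^ (m + 1) * w ^ (5 - h)) * x ^ (5 - h)"
    by (simp only: power_mult_distrib mult_ac)
  also have "w ^ (m + 1) * w ^ (5 - h) = w ^ (8 * k + 4) * w ^ (4 * k + 2)"
  proof -
    have "m + 1 + (5 - h) = 8 * k + 4 + (4 * k + 2)" using m by simp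
    then show ?thesis by (metis power_add)
  qed
  also have "x ^ (8 * k + 4) * (w ^ (8 * k + 4) * w ^ (4 * k + 2)) * x ^ (5 - h)
     = (x * w) ^ (8 * k + 4) * w ^ (4 * k + 2) * x ^ (5 - h)"
    by (simp only: power_mult_distrib mult_ac)
  finally have "x ^ (8 * k + 4) * w ^ (m + 1) = w ^ (4 * k + 2) * x ^ (5 - h)" by (simp add: xw)
  then have eq: "x ^ (8 * k + 4) * w ^ (m + 1) * t ^ (4 * k + 2) = (w * t) ^ (4 * k + 2) * x ^ (5 - h)"
    by (simp only: power_mult_distrib mult_ac)
  have "signed_pos 1 {i. even i} ((w * t) ^ (4 * k + 2) * x ^ (5 - h))"
  proof (rule signed_pos_mult)
    show "signed_pos 1 {i. even i} ((w * t) ^ (4 * k + 2))"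
      unfolding w_def t_def x_def by (rule signed_pos_inverse_power) auto
    show "signed_pos 1 {0..5 - h} (x ^ (5 - h))"
      using signed_pos_linear_power[of 1 "5 - h"] by (simp add: x_def)
  qed auto
  then have "fps_nth (x ^ (8 * k + 4) * w ^ (m + 1) * t ^ (4 * k + 2)) (2 * k) \<noteq> 0"
    unfolding eq by (intro signed_pos_nonzero) auto
  moreover have "of_nat (2 * k + 1) * a (2 * k + 1) = - of_nat m *
      fps_nth (x ^ (4 * (2 * k + 1)) * w ^ (m + 1) * t ^ (2 * (2 * k + 1))) (2 * k + 1 - 1)"
    unfolding w_def t_def x_def by (rule fps_expansion_coeff[OF F a]) (use L in auto)
  moreover have "4 * (2 * k + 1) = 8 * k + 4" "2 * (2 * k + 1) = 4 * k + 2" "2 * k + 1 - 1 = 2 * k"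
    by simp_all
  ultimately have "of_nat (2 * k + 1) * a (2 * k + 1) \<noteq> 0"
    using m(2) by (simp only:) simp
  then show ?thesis by auto
qed

section \<open>MacWilliams identity and shadows\<close>

instance bit :: finite
proof
  have "(UNIV :: bit set) = {0, 1}" by (auto intro: bit.exhaust)
  then show "finite (UNIV :: bit set)" by (metis finite.emptyI finite.insertI)
qed

lemma code_iff:
  fixes C :: "(bit ^ 'n) set"
  shows "code C \<longleftrightarrow> 0 \<in> C \<and> (\<forall>a\<in>C. \<forall>b\<in>C. a + b \<in> C)"
proof -
  have "c *s a \<in> C" if "0 \<in> C" "a \<in> C" for c and a :: "bit ^ 'n"
    using that by (cases c) simp_all
  then show ?thesis
    by (auto simp: code_def module.subspace_def[OF module_vec])
qed

lemma bit_vec_add_self [simp]: "(a :: bit ^ 'n) + a = 0"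
proof -
  have "b + b = 0" for b :: bit by (cases b) simp_all
  then show ?thesis by (simp add: vec_eq_iff)
qed

lemma bij_betw_translate:
  fixes C :: "(bit ^ 'n) set"
  assumes "code C" "b \<in> C"
  shows "bij_betw (\<lambda>a. a + b) C C"
  by (rule bij_betw_byWitness[where f' = "\<lambda>a. a + b"]) (use assms in \<open>auto simp: code_iff add.assoc\<close>)

text \<open>The nontrivial additive character of the binary field.\<close>

definition sgn_char :: "bit \<Rightarrow> complex" where
  "sgn_char b = (if b = 0 then 1 else - 1)"

lemma sgn_char_0 [simp]: "sgn_char 0 = 1"
  by (simp add: sgn_char_def)

lemma sgn_char_add: "sgn_char (a + b) = sgn_char a * sgn_char b"
  by (cases a; cases b) (simp_all add: sgn_char_def)

lemma sgn_char_sum: "finite A \<Longrightarrow> sgn_char (sum f A) = (\<Prod>i\<in>A. sgn_char (f i))"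
  by (induction A rule: finite_induct) (simp_all add: sgn_char_add del: add_bit_eq_xor)

lemma scalar_product_add_right:
  "scalar_product v (a + b) = scalar_product v a + scalar_product v (b :: 'a::comm_ring_1 ^ 'n)"
  by (simp add: scalar_product_def algebra_simps sum.distrib)

text \<open>Orthogonality of characters: if some \<open>b\<close> in \<open>C\<close> is not
  orthogonal to \<open>v\<close>, translation by \<open>b\<close> permutes \<open>C\<close> and
  negates the sum.\<close>

lemma sum_sgn_char_code:
  fixes C :: "(bit ^ 'n) set"
  assumes "code C"
  shows "(\<Sum>c\<in>C. sgn_char (scalar_product v c)) = (if v \<in> dual C then of_nat (card C) else 0)"
proof (cases "v \<in> dual C")
  case True
  then show ?thesis by (simp add: dual_def sgn_char_def)
next
  case False
  then obtain b where b: "b \<in> C" "scalar_product v b \<noteq> 0" by (auto simp: dual_def)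
  have "(\<Sum>c\<in>C. sgn_char (scalar_product v c)) = (\<Sum>c\<in>C. sgn_char (scalar_product v (c + b)))"
    by (rule sum.reindex_bij_betw[OF bij_betw_translate[OF assms b(1)], symmetric])
  also have "\<dots> = - (\<Sum>c\<in>C. sgn_char (scalar_product v c))"
  proof -
    have "sgn_char (scalar_product v b) = - 1" using b(2) by (simp add: sgn_char_def)
    then show ?thesis
      by (simp add: scalar_product_add_right sgn_char_add sum_negf del: add_bit_eq_xor)
  qed
  finally show ?thesis using False by simp
qed

text \<open>Complex arguments allow the substitutions by \<open>\<i>\<close> needed for the
  shadow.\<close>

definition weight_enum :: "(bit ^ 'n) set \<Rightarrow> complex \<Rightarrow> complex \<Rightarrow> complex" where
  "weight_enum C x y = (\<Sum>c\<in>C. x ^ (CARD('n) - weight c) * y ^ weight c)"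

lemma prod_bit_vec:
  "(\<Prod>i\<in>UNIV. if (c :: bit ^ 'n) $ i = 0 then x else y :: complex) = x ^ (CARD('n) - weight c) * y ^ weight c"
proof -
  have "card {i. c $ i = 0} + card {i. c $ i \<noteq> 0} = card ({i. c $ i = 0} \<union> {i. c $ i \<noteq> 0})"
    by (rule card_Un_disjoint[symmetric]) auto
  also have "{i. c $ i = 0} \<union> {i. c $ i \<noteq> 0} = UNIV" by blast
  finally have "card {i. c $ i = 0} = CARD('n) - card {i. c $ i \<noteq> 0}" by simp
  then show ?thesis
    by (simp add: prod.If_cases weight_def Collect_neg_eq[symmetric])
qed

lemma sum_prod_bit_vec:
  "(\<Sum>v\<in>UNIV. \<Prod>i\<in>UNIV. f i ((v :: bit ^ 'n) $ i)) = (\<Prod>i\<in>UNIV. f i 0 + f i 1 :: complex)"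
proof -
  have UNIV_bit: "(UNIV :: bit set) = {0, 1}" by (auto intro: bit.exhaust)
  have "(\<Prod>i\<in>UNIV. f i 0 + f i 1) = (\<Prod>i\<in>UNIV. \<Sum>b\<in>UNIV. f i b)"
    by (simp add: UNIV_bit)
  also have "\<dots> = (\<Sum>g\<in>PiE UNIV (\<lambda>_. UNIV). \<Prod>i\<in>UNIV. f i (g i))"
    by (rule prod_sum_PiE) (simp_all add: UNIV_bit)
  also have "\<dots> = (\<Sum>g\<in>UNIV. \<Prod>i\<in>UNIV. f i ((vec_lambda g :: bit ^ 'n) $ i))"
    by (simp add: PiE_UNIV_domain)
  also have "\<dots> = (\<Sum>v\<in>UNIV. \<Prod>i\<in>UNIV. f i ((v :: bit ^ 'n) $ i))"
    by (rule sum.reindex_bij_betw)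
      (auto intro!: bij_betw_byWitness[where f' = vec_nth] simp: vec_lambda_inverse vec_nth_inverse)
  finally show ?thesis by simp
qed

text \<open>A double sum over \<open>C\<close> and all vectors is evaluated twice: the sum over
  vectors factors over coordinates, while the sum over \<open>C\<close> is a character sum that
  selects the dual.\<close>

theorem macwilliams:
  fixes C :: "(bit ^ 'n) set"
  assumes "code C"
  shows "of_nat (card C) * weight_enum (dual C) x y = weight_enum C (x + y) (x - y)"
proof -
  let ?g = "\<lambda>v :: bit ^ 'n. \<Prod>i\<in>UNIV. if v $ i = 0 then x else y"
  have "weight_enum C (x + y) (x - y) = (\<Sum>c\<in>C. \<Prod>i\<in>UNIV. if c $ i = 0 then x + y else x - y)"
    by (simp add: weight_enum_def prod_bit_vec)
  also have "\<dots> = (\<Sum>c\<in>C. \<Sum>v\<in>UNIV. \<Prod>i\<in>UNIV. sgn_char (v $ i * c $ i) * (if v $ i = 0 then x else y))"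
    by (subst sum_prod_bit_vec) (intro sum.cong prod.cong, auto simp: sgn_char_def)
  also have "\<dots> = (\<Sum>c\<in>C. \<Sum>v\<in>UNIV. sgn_char (scalar_product v c) * ?g v)"
    by (simp only: prod.distrib scalar_product_def sgn_char_sum[OF finite])
  also have "\<dots> = (\<Sum>v\<in>UNIV. (\<Sum>c\<in>C. sgn_char (scalar_product v c)) * ?g v)"
    by (subst sum.swap) (simp only: sum_distrib_right)
  also have "\<dots> = (\<Sum>v\<in>UNIV. if v \<in> dual C then of_nat (card C) * ?g v else 0)"
    by (intro sum.cong) (simp_all add: sum_sgn_char_code[OF assms])
  also have "\<dots> = of_nat (card C) * (\<Sum>v\<in>dual C. ?g v)"
    using sum.inter_restrict[of UNIV "\<lambda>v. of_nat (card C) * ?g v" "dual C"]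
    by (simp add: sum_distrib_left)
  finally show ?thesis by (simp add: weight_enum_def prod_bit_vec)
qed

lemma weight_zero [simp]: "weight 0 = 0" by (simp add: weight_def)

lemma weight_eq_0_iff: "weight v = 0 \<longleftrightarrow> v = 0"
  by (auto simp: weight_def vec_eq_iff simp del: bit_not_zero_iff)

lemma weight_le: "weight (v :: bit ^ 'n) \<le> CARD('n)"
  unfolding weight_def by (rule card_mono) auto

lemma of_nat_bit_eq_0_iff: "of_nat k = (0 :: bit) \<longleftrightarrow> even k"
  by (induction k) (auto simp: add_eq_0_iff)

lemma scalar_product_bit:
  fixes a b :: "bit ^ 'n"
  shows "scalar_product a b = of_nat (card {i. a $ i = 1 \<and> b $ i = 1})"
proof -
  have "scalar_product a b = (\<Sum>i\<in>UNIV. if a $ i = 1 \<and> b $ i = 1 then 1 else 0)"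
    unfolding scalar_product_def by (intro sum.cong refl) auto
  then show ?thesis by (simp add: sum.If_cases)
qed

lemma weight_add:
  fixes a b :: "bit ^ 'n"
  shows "weight (a + b) + 2 * card {i. a $ i = 1 \<and> b $ i = 1} = weight a + weight b"
proof -
  let ?A = "{i. a $ i = 1}" and ?B = "{i. b $ i = 1}"
  have "{i. (a + b) $ i = 1} = (?A - ?B) \<union> (?B - ?A)"
  proof -
    have "u + v = 1 \<longleftrightarrow> (u = 1 \<and> v \<noteq> 1) \<or> (v = 1 \<and> u \<noteq> 1)" for u v :: bit
      by (cases u; cases v) simp_all
    then show ?thesis by auto
  qed
  then have "card {i. (a + b) $ i = 1} = card (?A - ?B) + card (?B - ?A)"
    by (simp only:) (subst card_Un_disjoint, auto)
  moreover have "card ?A = card (?A - ?B) + card (?A \<inter> ?B)"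
    by (subst card_Un_disjoint[symmetric]) (auto intro: arg_cong[of _ _ card])
  moreover have "card ?B = card (?B - ?A) + card (?A \<inter> ?B)"
    by (subst card_Un_disjoint[symmetric]) (auto intro: arg_cong[of _ _ card])
  moreover have "{i. a $ i = 1 \<and> b $ i = 1} = ?A \<inter> ?B" by auto
  ultimately show ?thesis by (simp add: weight_def)
qed

section \<open>Binary self-dual codes and their shadows\<close>

context
  fixes C :: "(bit ^ 'n) set"
  assumes sd: "self_dual C"
begin

lemma self_dual_code: "code C" using sd by (simp add: self_dual_def)

lemma self_dual_zero: "0 \<in> C" using self_dual_code by (simp add: code_iff)

lemma self_dual_add: "a \<in> C \<Longrightarrow> b \<in> C \<Longrightarrow> a + b \<in> C" using self_dual_code by (simp add: code_iff)

lemma self_dual_dual: "dual C = C" using sd by (simp add: self_dual_def)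

lemma self_dual_overlap:
  assumes "a \<in> C" "b \<in> C"
  shows "even (card {i. a $ i = 1 \<and> b $ i = 1})"
proof -
  have "a \<in> dual C" using assms(1) by (simp add: self_dual_dual)
  then have "scalar_product a b = 0" using assms(2) by (simp add: dual_def)
  then show ?thesis by (simp add: scalar_product_bit of_nat_bit_eq_0_iff)
qed

lemma self_dual_even_weight: "c \<in> C \<Longrightarrow> even (weight c)"
  using self_dual_overlap[of c c] by (simp add: weight_def)

text \<open>Supports of codewords overlap in an even number of places, so the correction in
  \<open>weight_add\<close> is a multiple of 4.\<close>

lemma self_dual_weight_add:
  assumes "a \<in> C" "b \<in> C"
  shows "weight (a + b) mod 4 = (weight a + weight b) mod 4"
proof -
  obtain l where "card {i. a $ i = 1 \<and> b $ i = 1} = 2 * l"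
    using self_dual_overlap[OF assms] by blast
  then have "weight a + weight b = weight (a + b) + 4 * l" using weight_add[of a b] by simp
  then show ?thesis by simp
qed

lemma doubly_even_subcode_code: "code (doubly_even_subcode C)"
proof -
  have "weight (a + b) mod 4 = 0" if "a \<in> C" "b \<in> C" "weight a mod 4 = 0" "weight b mod 4 = 0" for a b
    using self_dual_weight_add[OF that(1,2)] that(3,4) by (metis add_0 mod_add_left_eq)
  then show ?thesis
    unfolding code_iff doubly_even_subcode_def using self_dual_zero self_dual_add by auto
qed

lemma self_dual_weight_enum:
  "of_nat (card C) * weight_enum C x y = weight_enum C (x + y) (x - y)"
  using macwilliams[OF self_dual_code] by (simp add: self_dual_dual)

lemma weight_enum_x_0: "weight_enum C x 0 = x ^ CARD('n)"
proof -
  have "weight_enum C x 0 = (\<Sum>c\<in>C. if c = 0 then x ^ CARD('n) else 0)"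
    unfolding weight_enum_def by (intro sum.cong) (auto simp: power_0_left weight_eq_0_iff)
  then show ?thesis using self_dual_zero by simp
qed

text \<open>At \<open>x = y = 1\<close> the MacWilliams identity reads
  \<open>|C|^2 = 2^n\<close>.\<close>

lemma self_dual_card:
  assumes "CARD('n) = 2 * m"
  shows "card C = 2 ^ m"
proof -
  have "(of_nat (card C * card C) :: complex) = of_nat (2 ^ m * 2 ^ m)"
    using self_dual_weight_enum[of 1 1] 
    by (simp add: weight_enum_x_0 assms) (simp add: weight_enum_def mult_2 power_add)
  then have "card C * card C = 2 ^ m * 2 ^ m" by (simp only: of_nat_eq_iff)
  then have "(card C) ^ 2 = (2 ^ m) ^ 2" by (simp add: power2_eq_square)
  then show ?thesis by (simp only: power2_eq_iff_nonneg[OF zero_le zero_le])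
qed

text \<open>Translation by a word of weight 2 modulo 4 exchanges the doubly even subcode with its
  complement in \<open>C\<close>.\<close>

lemma card_doubly_even_subcode:
  assumes "singly_even C"
  shows "card C = 2 * card (doubly_even_subcode C)"
proof -
  let ?E = "doubly_even_subcode C"
  obtain b where b: "b \<in> C" "weight b mod 4 = 2" using assms by (auto simp: singly_even_def)
  have "bij_betw (\<lambda>a. a + b) ?E (C - ?E)"
  proof (rule bij_betw_byWitness[where f' = "\<lambda>a. a + b"])
    have swap: "weight (a + b) mod 4 = 0 \<longleftrightarrow> weight a mod 4 \<noteq> 0" if "a \<in> C" for a
    proof -
      have "weight (a + b) mod 4 = (weight a mod 4 + 2) mod 4"
        using self_dual_weight_add[OF that b(1)] by (simp only: mod_add_eq flip: b(2))
      moreover have "weight a mod 4 = 0 \<or> weight a mod 4 = 2"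
        using self_dual_even_weight[OF that] by presburger
      ultimately show ?thesis by (elim disjE) simp_all
    qed
    have E_iff: "a \<in> ?E \<longleftrightarrow> a \<in> C \<and> weight a mod 4 = 0" for a
      by (simp add: doubly_even_subcode_def)
    have translate: "a + b \<in> C - ?E \<longleftrightarrow> a \<in> ?E" "a + b \<in> ?E \<longleftrightarrow> a \<in> C - ?E" if "a \<in> C" for a
      using that swap[OF that] self_dual_add[OF that b(1)] by (simp_all only: E_iff Diff_iff) simp_all
    show "(\<lambda>a. a + b) ` ?E \<subseteq> C - ?E"
    proof (rule image_subsetI)
      fix a assume a: "a \<in> ?E"
      then have "a \<in> C" by (simp only: E_iff)
      then show "a + b \<in> C - ?E" using a by (simp only: translate)
    qed
    show "(\<lambda>a. a + b) ` (C - ?E) \<subseteq> ?E"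
    proof (rule image_subsetI)
      fix a assume a: "a \<in> C - ?E"
      then have "a \<in> C" by (rule DiffD1)
      then show "a + b \<in> ?E" using a by (simp only: translate)
    qed
  qed (auto simp: add.assoc)
  then have "card ?E = card (C - ?E)" by (rule bij_betw_same_card)
  also have "\<dots> = card C - card ?E"
    by (rule card_Diff_subset) (auto simp: doubly_even_subcode_def)
  finally have "card ?E = card C - card ?E" .
  moreover have "card ?E \<le> card C"
    by (rule card_mono) (auto simp: doubly_even_subcode_def)
  ultimately show ?thesis by linarith
qed

lemma imaginary_power_mod: "\<i> ^ k = \<i> ^ (k mod 4)"
proof -
  have "\<i> ^ k = \<i> ^ (4 * (k div 4) + k mod 4)" by (simp only: mult_div_mod_eq)
  also have "\<dots> = (\<i> ^ 4) ^ (k div 4) * \<i> ^ (k mod 4)" by (simp only: power_add power_mult)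
  also have "\<i> ^ 4 = 1" by (simp add: power4_eq_xxxx)
  finally show ?thesis by simp
qed

text \<open>Since weights are even, \<open>\<i> ^ weight c\<close> is 1 on the subcode and -1 on the
  rest of \<open>C\<close>.\<close>

lemma weight_enum_doubly_even_subcode:
  "2 * weight_enum (doubly_even_subcode C) x y = weight_enum C x y + weight_enum C x (\<i> * y)"
proof -
  have i_pow: "1 + \<i> ^ weight c = (if weight c mod 4 = 0 then 2 else 0)" if c: "c \<in> C" for c
  proof -
    have "weight c mod 4 = 0 \<or> weight c mod 4 = 2"
      using self_dual_even_weight[OF c] by presburger
    then show ?thesis by (subst imaginary_power_mod) (elim disjE; simp)
  qed
  have "weight_enum C x y + weight_enum C x (\<i> * y)
      = (\<Sum>c\<in>C. (1 + \<i> ^ weight c) * (x ^ (CARD('n) - weight c) * y ^ weight c))"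
    unfolding weight_enum_def sum.distrib[symmetric]
    by (intro sum.cong refl) (simp only: power_mult_distrib distrib_right distrib_left mult_1_left mult_ac)
  also have "\<dots> = (\<Sum>c\<in>C. if weight c mod 4 = 0 then 2 * (x ^ (CARD('n) - weight c) * y ^ weight c) else 0)"
    by (intro sum.cong refl) (simp only: i_pow split: if_split, simp)
  also have "\<dots> = 2 * weight_enum (doubly_even_subcode C) x y"
    unfolding weight_enum_def doubly_even_subcode_def sum_distrib_left
    by (rule sum.inter_filter[symmetric]) simp
  finally show ?thesis by simp
qed

lemma subset_dual_doubly_even_subcode: "C \<subseteq> dual (doubly_even_subcode C)"
  using self_dual_dual by (auto simp: dual_def doubly_even_subcode_def)

text \<open>MacWilliams for the doubly even subcode gives two terms; by self-duality one of them is
  the contribution of \<open>C\<close> to the dual, so the other belongs to the shadow.\<close>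

lemma weight_enum_shadow:
  assumes "singly_even C"
  shows "of_nat (card C) * weight_enum (shadow C) x y = weight_enum C (x + y) (\<i> * (x - y))"
proof -
  let ?E = "doubly_even_subcode C"
  have "of_nat (card C) * weight_enum (dual ?E) x y
      = 2 * (of_nat (card ?E) * weight_enum (dual ?E) x y)"
    by (simp add: card_doubly_even_subcode[OF assms])
  also have "\<dots> = weight_enum C (x + y) (x - y) + weight_enum C (x + y) (\<i> * (x - y))"
    by (simp add: macwilliams doubly_even_subcode_code weight_enum_doubly_even_subcode)
  also have "weight_enum C (x + y) (x - y) = of_nat (card C) * weight_enum C x y"
    by (simp add: self_dual_weight_enum)
  also have "weight_enum (dual ?E) x y = weight_enum C x y + weight_enum (shadow C) x y"
    unfolding weight_enum_def shadow_def
    by (subst sum.subset_diff[OF subset_dual_doubly_even_subcode]) simp_all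
  finally show ?thesis by (simp add: algebra_simps)
qed

text \<open>If \<open>C\<close> were doubly even, its weight enumerator would also be invariant under
  \<open>y \<mapsto> \<i> y\<close>; together with the MacWilliams transform this generates a scalar matrix of order 8.\<close>

lemma self_dual_singly_even:
  assumes n: "CARD('n) = 2 * m" and m: "\<not> 4 dvd m"
  shows "singly_even C"
proof (rule ccontr)
  assume "\<not> singly_even C"
  then have not2: "weight c mod 4 \<noteq> 2" if "c \<in> C" for c using sd that by (auto simp: singly_even_def)
  have "weight c mod 4 = 0" if "c \<in> C" for c
  proof -
    have "weight c mod 4 = 0 \<or> weight c mod 4 = 2"
      using self_dual_even_weight[OF that] by presburger
    then show ?thesis using not2[OF that] by blast
  qed
  then have "doubly_even_subcode C = C" by (auto simp: doubly_even_subcode_def)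
  then have i_inv: "weight_enum C x (\<i> * y) = weight_enum C x y" for x y
    using weight_enum_doubly_even_subcode[of x y] by simp
  have M: "2 ^ m * weight_enum C x y = weight_enum C (x + y) (\<i> * (x - y))" for x y
    using self_dual_weight_enum[of x y] by (simp add: i_inv self_dual_card[OF n])
  have diag: "weight_enum C x x = x ^ (2 * m) * 2 ^ m" for x
  proof -
    have "weight_enum C x x = (\<Sum>c\<in>C. x ^ (2 * m))"
      unfolding weight_enum_def
      by (intro sum.cong refl) (simp add: n[symmetric] weight_le flip: power_add)
    then show ?thesis by (simp add: self_dual_card[OF n])
  qed
  \<comment> \<open>Two applications of \<open>M\<close> lead from \<open>(1, 0)\<close> through
    \<open>(1, \<i>)\<close> to the diagonal point \<open>(1 + \<i>, 1 + \<i>)\<close>, where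
    \<open>diag\<close> gives the value directly. Comparison yields
    \<open>\<i> ^ m = 1\<close>.\<close>
  have "2 ^ m = weight_enum C 1 \<i>"
    using M[of 1 0] by (simp add: weight_enum_x_0)
  then have "2 ^ m * 2 ^ m = weight_enum C (1 + \<i>) (1 + \<i>)"
    using M[of 1 \<i>] by (simp add: algebra_simps)
  also have "\<dots> = (2 * \<i>) ^ m * 2 ^ m"
  proof -
    have "(1 + \<i>) ^ 2 = 2 * \<i>" by (simp add: power2_eq_square algebra_simps)
    then show ?thesis by (simp only: diag power_mult)
  qed
  finally have i_pow: "\<i> ^ m = 1" by (simp add: power_mult_distrib)
  define r where "r = m mod 4"
  have "\<i> ^ r = 1" using i_pow by (simp only: r_def imaginary_power_mod[of m])
  moreover have "r \<noteq> 0" "r < 4"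
    using m by (simp_all add: r_def mod_eq_0_iff_dvd)
  then have "r = 1 \<or> r = 2 \<or> r = 3" by linarith
  ultimately show False
    by (elim disjE) (simp_all add: power3_eq_cube complex_eq_iff)
qed

end

section \<open>Lee weights and residue codes of self-dual codes over the integers modulo 4\<close>

lemma z4_cases: "(a :: z4) = 0 \<or> a = 1 \<or> a = 2 \<or> a = 3"
proof (cases a rule: bit0_cases)
  case (of_int z)
  then have "z = 0 \<or> z = 1 \<or> z = 2 \<or> z = 3" by auto
  then show ?thesis using of_int by auto
qed

lemma z4_of_nat_eq_0_iff: "of_nat k = (0 :: z4) \<longleftrightarrow> 4 dvd k"
  by (simp add: of_nat_eq_0_iff_char_dvd)

lemma z4_square: "(a :: z4) * a = (if z4_mod2 a = 0 then 0 else 1)"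
  using z4_cases[of a] by auto

lemma z4_double: "2 * (a :: z4) = (if z4_mod2 a = 0 then 0 else 2)"
  using z4_cases[of a] by auto

text \<open>Squares modulo 4 are 0 or 1 according to parity, so the norm of a codeword counts its
  odd coordinates modulo 4.\<close>

lemma residue_doubly_even:
  fixes \<C> :: "(z4 ^ 'n) set"
  assumes "self_dual \<C>" "x \<in> residue_code \<C>"
  shows "weight x mod 4 = 0"
proof -
  from assms(2) obtain c where c: "c \<in> \<C>" and x: "x = (\<chi> j. z4_mod2 (c $ j))"
    by (auto simp: residue_code_def)
  have "scalar_product c c = 0" using assms(1) c by (auto simp: self_dual_def dual_def)
  moreover have "scalar_product c c = of_nat (weight x)"
    by (simp add: scalar_product_def z4_square x weight_def sum.If_cases Collect_neg_eq[symmetric])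
  ultimately show ?thesis by (simp add: z4_of_nat_eq_0_iff dvd_eq_mod_eq_0)
qed

text \<open>The inner product of \<open>2v\<close> with \<open>c\<close> is twice that of
  \<open>v\<close> with the residue of \<open>c\<close>, hence zero modulo 4 when the latter is
  even.\<close>

lemma double_in_self_dual:
  fixes \<C> :: "(z4 ^ 'n) set"
  assumes "self_dual \<C>" "v \<in> dual (residue_code \<C>)"
  shows "(\<chi> j. if v $ j = 0 then 0 else 2) \<in> \<C>" (is "?w \<in> \<C>")
proof -
  have "scalar_product ?w c = 0" if c: "c \<in> \<C>" for c
  proof -
    define x where "x = (\<chi> j. z4_mod2 (c $ j))"
    have "x \<in> residue_code \<C>" using c by (auto simp: residue_code_def x_def)
    then have "scalar_product v x = 0" using assms(2) by (simp add: dual_def)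
    then obtain l where l: "card {i. v $ i = 1 \<and> x $ i = 1} = 2 * l"
      by (auto simp: scalar_product_bit of_nat_bit_eq_0_iff)
    have "scalar_product ?w c = (\<Sum>i\<in>UNIV. if v $ i = 1 \<and> x $ i = 1 then 2 else 0)"
      unfolding scalar_product_def by (intro sum.cong refl) (auto simp: z4_double x_def)
    also have "\<dots> = of_nat (2 * l) * 2" by (simp add: sum.If_cases l)
    also have "\<dots> = of_nat (4 * l)" by simp
    also have "\<dots> = 0" by (simp only: z4_of_nat_eq_0_iff) simp
    finally show ?thesis .
  qed
  then show ?thesis using assms(1) by (auto simp: self_dual_def dual_def)
qed

lemma lee_weight_double:
  fixes v :: "bit ^ 'n"
  shows "lee_weight (\<chi> j. if v $ j = 0 then 0 else 2) = 2 * weight v"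
proof -
  let ?w = "(\<chi> j. if v $ j = 0 then 0 else 2) :: z4 ^ 'n"
  have "num_comp 1 ?w = 0" "num_comp 3 ?w = 0" "num_comp 2 ?w = weight v"
    unfolding num_comp_def weight_def by (auto intro: arg_cong[of _ _ card])
  then show ?thesis by (simp add: lee_weight_def)
qed

lemma weight_dual_residue_ge:
  fixes \<C> :: "(z4 ^ 'n) set"
  assumes "self_dual \<C>" "v \<in> dual (residue_code \<C>)" "v \<noteq> 0"
  shows "min_lee_weight \<C> \<le> 2 * weight v"
proof -
  let ?w = "(\<chi> j. if v $ j = 0 then 0 else 2) :: z4 ^ 'n"
  have "?w \<noteq> 0" using assms(3) by (auto simp: vec_eq_iff simp del: bit_not_zero_iff)
  then have "lee_weight ?w \<in> lee_weight ` (\<C> - {0})"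
    using double_in_self_dual[OF assms(1,2)] by blast
  then show ?thesis unfolding min_lee_weight_def lee_weight_double by (intro Min_le) simp_all
qed

section \<open>Weight enumerators of self-dual codes\<close>

definition weight_poly :: "(bit ^ 'n) set \<Rightarrow> complex poly" where
  "weight_poly S = (\<Sum>s\<in>S. monom 1 (weight s))"

lemma degree_weight_poly: "degree (weight_poly (S :: (bit ^ 'n) set)) \<le> CARD('n)"
  unfolding weight_poly_def
  by (intro degree_sum_le) (auto intro: order.trans[OF degree_monom_le weight_le])

lemma coeff_weight_poly: "coeff (weight_poly S) w = of_nat (card {s \<in> S. weight s = w})"
proof -
  have "coeff (weight_poly S) w = (\<Sum>s\<in>S. if weight s = w then 1 else 0)"
    by (simp add: weight_poly_def coeff_sum)
  also have "\<dots> = (\<Sum>s\<in>{s \<in> S. weight s = w}. 1)"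
    by (rule sum.inter_filter[symmetric]) simp
  finally show ?thesis by simp
qed

lemma weight_enum_eq_poly:
  fixes S :: "(bit ^ 'n) set"
  assumes "x \<noteq> 0"
  shows "weight_enum S x y = x ^ CARD('n) * poly (weight_poly S) (y / x)"
proof -
  have "x ^ (CARD('n) - weight s) * y ^ weight s = x ^ CARD('n) * (y / x) ^ weight s" for s :: "bit ^ 'n"
  proof -
    have "x ^ CARD('n) = x ^ (CARD('n) - weight s) * x ^ weight s"
      using weight_le[of s] by (simp flip: power_add)
    then show ?thesis using assms by (simp add: power_divide)
  qed
  then show ?thesis
    by (simp add: weight_enum_def weight_poly_def poly_sum poly_monom sum_distrib_left)
qed

lemma gleason_weight_poly:
  fixes C :: "(bit ^ 'n) set"
  assumes C: "self_dual C" and n: "CARD('n) = 2 * m"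
  obtains a where "\<And>j. m div 4 < j \<Longrightarrow> a j = 0"
    "weight_poly C = (\<Sum>j\<le>m div 4. smult (a j) ([:1, 0, 1:] ^ (m - 4 * j) * gleason8 ^ j))"
proof -
  let ?p = "weight_poly C"
  have deg: "degree ?p \<le> 2 * m" using degree_weight_poly[of C] n by simp
  have even: "poly ?p (- y) = poly ?p y" for y
    unfolding weight_poly_def poly_sum poly_monom
    using self_dual_even_weight[OF C] by (intro sum.cong) auto
  have cay: "cayley (2 * m) ?p = smult (2 ^ m) ?p"
  proof (rule poly_eqI_but_one[of "-1"])
    fix y :: complex assume y: "y \<noteq> - 1"
    then have "1 + y \<noteq> 0" by (metis add_eq_0_iff minus_minus)
    then show "poly (cayley (2 * m) ?p) y = poly (smult (2 ^ m) ?p) y"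
      using self_dual_weight_enum[OF C, of 1 y]
      by (simp add: poly_cayley[OF deg y] weight_enum_eq_poly self_dual_card[OF C n] n)
  qed
  obtain a where a: "?p = (\<Sum>j\<le>m div 4. smult (a j) ([:1, 0, 1:] ^ (m - 4 * j) * gleason8 ^ j))"
    using gleason[OF deg even cay] by blast
  \<comment> \<open>Gleason's theorem leaves the coefficients beyond \<open>m div 4\<close>
    unspecified; they are set to 0.\<close>
  show thesis
  proof (rule that[of "\<lambda>j. if j \<le> m div 4 then a j else 0"])
    show "?p = (\<Sum>j\<le>m div 4. smult (if j \<le> m div 4 then a j else 0) ([:1, 0, 1:] ^ (m - 4 * j) * gleason8 ^ j))"
      by (subst a) (intro sum.cong, auto)
  qed simp
qed

text \<open>Since all weights are even, the expansion may be read in the variable \<open>y\<^sup>2\<close>.\<close>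

lemma weight_fps_expansion:
  fixes C :: "(bit ^ 'n) set"
  assumes C: "self_dual C"
    and a: "weight_poly C = (\<Sum>j\<le>m div 4. smult (a j) ([:1, 0, 1:] ^ (m - 4 * j) * gleason8 ^ j))"
    and L: "\<And>c. c \<in> C \<Longrightarrow> c \<noteq> 0 \<Longrightarrow> 2 * L \<le> weight c"
  shows "\<exists>R. (\<Sum>j\<le>m div 4. fps_const (a j) * ((1 + fps_X) ^ (m - 4 * j) * (fps_X * (1 - fps_X) ^ 2) ^ j))
      = 1 + fps_X ^ L * R"
proof -
  define P :: "complex poly" where "P = (\<Sum>c\<in>C. monom 1 (weight c div 2))"
  define Q :: "complex poly" where
    "Q = (\<Sum>j\<le>m div 4. smult (a j) ([:1, 1:] ^ (m - 4 * j) * ([:0, 1:] * [:1, -1:] ^ 2) ^ j))"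
  have "P = Q"
  proof (rule poly_eqI_but_one[of 0])
    fix z :: complex
    \<comment> \<open>Every value of the new variable is a square, so both sides can be compared at
      a square root.\<close>
    define y where "y = csqrt z"
    have y: "y ^ 2 = z" by (simp add: y_def)
    have "poly P z = poly (weight_poly C) y"
      unfolding P_def weight_poly_def poly_sum poly_monom y[symmetric]
      using self_dual_even_weight[OF C] by (intro sum.cong) (auto simp flip: power_mult)
    also have "\<dots> = poly Q z"
      unfolding a Q_def poly_sum y[symmetric]
      by (intro sum.cong) (simp_all add: poly_power poly_gleason8 power2_eq_square[of y])
    finally show "poly P z = poly Q z" .
  qed
  moreover have "fps_of_poly P = 1 + fps_X ^ L * (\<Sum>c\<in>C - {0}. fps_X ^ (weight c div 2 - L))"
  proof -
    have "fps_of_poly P = (\<Sum>c\<in>C. fps_X ^ (weight c div 2))"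
      by (simp add: P_def fps_of_poly_sum fps_of_poly_monom')
    also have "\<dots> = 1 + (\<Sum>c\<in>C - {0}. fps_X ^ (weight c div 2))"
      using self_dual_zero[OF C] by (subst sum.remove[of _ 0]) simp_all
    also have "(\<Sum>c\<in>C - {0}. fps_X ^ (weight c div 2)) = (\<Sum>c\<in>C - {0}. fps_X ^ L * fps_X ^ (weight c div 2 - L) :: complex fps)"
    proof (intro sum.cong refl)
      fix c assume "c \<in> C - {0}"
      then have "L \<le> weight c div 2" using L[of c] by simp
      then show "fps_X ^ (weight c div 2) = fps_X ^ L * (fps_X ^ (weight c div 2 - L) :: complex fps)"
        by (simp flip: power_add)
    qed
    finally show ?thesis by (simp add: sum_distrib_left)
  qed
  moreover have "fps_of_poly Q
      = (\<Sum>j\<le>m div 4. fps_const (a j) * ((1 + fps_X) ^ (m - 4 * j) * (fps_X * (1 - fps_X) ^ 2) ^ j))"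
  proof -
    have "fps_of_poly [:1, 1:] = (1 + fps_X :: complex fps)"
      "fps_of_poly [:1, -1:] = (1 - fps_X :: complex fps)"
      by (simp_all add: fps_of_poly_linear' flip: fps_const_neg)
    then show ?thesis
      by (simp only: Q_def fps_of_poly_sum fps_of_poly_smult fps_of_poly_mult fps_of_poly_power fps_of_poly_fps_X)
  qed
  ultimately show ?thesis by metis
qed

text \<open>Substituting \<open>t = \<i> (1 - y) / (1 + y)\<close> in Gleason's expansion turns
  \<open>1 + t^2\<close> into \<open>4y / (1 + y)^2\<close> and \<open>gleason8\<close> into
  \<open>-4 (1 - y^4)^2 / (1 + y)^8\<close>.\<close>

lemma weight_poly_shadow:
  fixes C :: "(bit ^ 'n) set"
  assumes C: "self_dual C" and n: "CARD('n) = 2 * m" and se: "singly_even C"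
    and a: "weight_poly C = (\<Sum>j\<le>m div 4. smult (a j) ([:1, 0, 1:] ^ (m - 4 * j) * gleason8 ^ j))"
  shows "smult (2 ^ m) (weight_poly (shadow C))
    = (\<Sum>j\<le>m div 4. smult (a j * 4 ^ (m - 4 * j) * (-4) ^ j)
        (monom 1 (m - 4 * j) * [:1, 0, 0, 0, -1:] ^ (2 * j)))"
proof (rule poly_eqI_but_one[of "-1"])
  fix y :: complex assume "y \<noteq> - 1"
  then have y: "1 + y \<noteq> 0" by (metis add_eq_0_iff minus_minus)
  define t where "t = \<i> * (1 - y) / (1 + y)"
  have ty: "t * (1 + y) = \<i> * (1 - y)" using y by (simp add: t_def)
  have ty2: "(t * (1 + y)) ^ 2 = - ((1 - y) ^ 2)" by (simp add: ty power_mult_distrib)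
  have quad: "(1 + y) ^ 2 * (1 + t ^ 2) = 4 * y"
  proof -
    have "(1 + y) ^ 2 * (1 + t ^ 2) = (1 + y) ^ 2 + (t * (1 + y)) ^ 2" by algebra
    also have "\<dots> = 4 * y" unfolding ty2 by algebra
    finally show ?thesis .
  qed
  have oct: "(1 + y) ^ 8 * poly gleason8 t = -4 * (1 - y ^ 4) ^ 2"
  proof -
    have "(1 + y) ^ 8 * poly gleason8 t
        = (t * (1 + y)) ^ 2 * ((1 + y) ^ 2 - (t * (1 + y)) ^ 2) ^ 2 * (1 + y) ^ 2"
      unfolding poly_gleason8 by algebra
    also have "\<dots> = -4 * (1 - y ^ 4) ^ 2" unfolding ty2 by algebra
    finally show ?thesis .
  qed
  have summand: "(1 + y) ^ (2 * m) * ((1 + t ^ 2) ^ (m - 4 * j) * poly gleason8 t ^ j)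
      = 4 ^ (m - 4 * j) * (-4) ^ j * (y ^ (m - 4 * j) * (1 - y ^ 4) ^ (2 * j))" if "j \<le> m div 4" for j
  proof -
    have "2 * m = 2 * (m - 4 * j) + 8 * j" using that by simp
    then have "(1 + y) ^ (2 * m) = ((1 + y) ^ 2) ^ (m - 4 * j) * ((1 + y) ^ 8) ^ j"
      by (simp only: power_add power_mult)
    then have "(1 + y) ^ (2 * m) * ((1 + t ^ 2) ^ (m - 4 * j) * poly gleason8 t ^ j)
        = ((1 + y) ^ 2 * (1 + t ^ 2)) ^ (m - 4 * j) * ((1 + y) ^ 8 * poly gleason8 t) ^ j"
      by (simp only: power_mult_distrib mult_ac)
    also have "\<dots> = (4 * y) ^ (m - 4 * j) * (-4 * (1 - y ^ 4) ^ 2) ^ j" by (simp only: quad oct)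
    also have "\<dots> = 4 ^ (m - 4 * j) * (-4) ^ j * (y ^ (m - 4 * j) * (1 - y ^ 4) ^ (2 * j))"
      by (simp only: power_mult[symmetric] power_mult_distrib mult_ac)
    finally show ?thesis .
  qed
  have "poly (smult (2 ^ m) (weight_poly (shadow C))) y = weight_enum C (1 + y) (\<i> * (1 - y))"
    using weight_enum_shadow[OF C se, of 1 y] by (simp add: weight_enum_eq_poly self_dual_card[OF C n])
  also have "\<dots> = (1 + y) ^ (2 * m) * poly (weight_poly C) t"
    using y by (simp add: weight_enum_eq_poly n t_def)
  also have "\<dots> = (\<Sum>j\<le>m div 4. a j * ((1 + y) ^ (2 * m) * ((1 + t ^ 2) ^ (m - 4 * j) * poly gleason8 t ^ j)))"
    unfolding a by (simp add: poly_sum poly_power sum_distrib_left power2_eq_square[of t] mult_ac)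
  also have "\<dots> = (\<Sum>j\<le>m div 4. a j * (4 ^ (m - 4 * j) * (-4) ^ j * (y ^ (m - 4 * j) * (1 - y ^ 4) ^ (2 * j))))"
    by (intro sum.cong refl) (simp only: summand atMost_iff)
  also have "\<dots> = poly (\<Sum>j\<le>m div 4. smult (a j * 4 ^ (m - 4 * j) * (-4) ^ j)
        (monom 1 (m - 4 * j) * [:1, 0, 0, 0, -1:] ^ (2 * j))) y"
    by (simp add: poly_sum poly_power poly_monom power4_eq_xxxx mult_ac)
  finally show "poly (smult (2 ^ m) (weight_poly (shadow C))) y
    = poly (\<Sum>j\<le>m div 4. smult (a j * 4 ^ (m - 4 * j) * (-4) ^ j)
        (monom 1 (m - 4 * j) * [:1, 0, 0, 0, -1:] ^ (2 * j))) y" .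
qed

text \<open>Only the last nonvanishing term contributes to the lowest power of \<open>y\<close> in the shadow.\<close>

lemma min_weight_shadow:
  fixes C :: "(bit ^ 'n) set"
  assumes C: "self_dual C" and n: "CARD('n) = 2 * m" and se: "singly_even C"
    and a: "weight_poly C = (\<Sum>j\<le>m div 4. smult (a j) ([:1, 0, 1:] ^ (m - 4 * j) * gleason8 ^ j))"
    and J: "a J \<noteq> 0" "J \<le> m div 4" and max: "\<And>j. J < j \<Longrightarrow> a j = 0"
  shows "min_weight (shadow C) = m - 4 * J" "\<exists>s\<in>shadow C. weight s = m - 4 * J"
proof -
  let ?S = "shadow C"
  have coeff: "2 ^ m * coeff (weight_poly ?S) w
      = (\<Sum>j\<le>m div 4. a j * 4 ^ (m - 4 * j) * (-4) ^ j
          * (if w < m - 4 * j then 0 else coeff ([:1, 0, 0, 0, -1:] ^ (2 * j)) (w - (m - 4 * j))))" for w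
    using arg_cong[OF weight_poly_shadow[OF C n se a], of "\<lambda>p. coeff p w"]
    by (simp add: coeff_sum coeff_monom_mult not_le[symmetric] if_distrib cong: if_cong)
  have low: "2 ^ m * coeff (weight_poly ?S) w
      = (if w = m - 4 * J then a J * 4 ^ (m - 4 * J) * (-4) ^ J else 0)" if w: "w \<le> m - 4 * J" for w
  proof -
    have "2 ^ m * coeff (weight_poly ?S) w
      = (\<Sum>j\<le>m div 4. if j = J then (if w = m - 4 * J then a J * 4 ^ (m - 4 * J) * (-4) ^ J else 0) else 0)"
      unfolding coeff
    proof (intro sum.cong refl)
      fix j assume j: "j \<in> {..m div 4}"
      \<comment> \<open>The lowest exponent of term \<open>j\<close> is \<open>m - 4 * j\<close>:
        earlier terms start above \<open>w\<close>, and later ones have coefficient 0.\<close>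
      consider "j < J" | "j = J" | "J < j" by linarith
      then show "a j * 4 ^ (m - 4 * j) * (-4) ^ j
          * (if w < m - 4 * j then 0 else coeff ([:1, 0, 0, 0, -1:] ^ (2 * j)) (w - (m - 4 * j)))
        = (if j = J then (if w = m - 4 * J then a J * 4 ^ (m - 4 * J) * (-4) ^ J else 0) else 0)"
      proof cases
        case 1
        then have "w < m - 4 * j" using w J(2) by linarith
        then show ?thesis using 1 by simp
      next
        case 2
        have "coeff ([:1, 0, 0, 0, -1:] ^ (2 * j)) 0 = (1 :: complex)"
          by (simp add: poly_0_coeff_0[symmetric] poly_power)
        then show ?thesis using 2 w by auto
      next
        case 3
        then show ?thesis by (simp add: max)
      qed
    qed
    then show ?thesis using J(2) by simp
  qed
  have "coeff (weight_poly ?S) (m - 4 * J) \<noteq> 0"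
    using low[of "m - 4 * J"] J(1) by auto
  then have "{s \<in> ?S. weight s = m - 4 * J} \<noteq> {}"
    by (metis coeff_weight_poly card.empty of_nat_0)
  then show ex: "\<exists>s\<in>?S. weight s = m - 4 * J" by blast
  have ge: "m - 4 * J \<le> weight s" if s: "s \<in> ?S" for s
  proof (rule ccontr)
    assume "\<not> m - 4 * J \<le> weight s"
    then have "coeff (weight_poly ?S) (weight s) = 0" using low[of "weight s"] by simp
    then have "card {s' \<in> ?S. weight s' = weight s} = 0" by (simp add: coeff_weight_poly)
    then show False using s by auto
  qed
  have "0 \<notin> ?S" using self_dual_zero[OF C] by (simp add: shadow_def)
  then have "min_weight ?S = Min (weight ` ?S)" by (simp add: min_weight_def)
  also have "\<dots> = m - 4 * J"
    by (rule Min_eqI) (use ex ge in \<open>auto intro: rev_image_eqI\<close>)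
  finally show "min_weight ?S = m - 4 * J" .
qed

section \<open>Minimum weights of the code and of its shadow\<close>

theorem proposition5p1:
  fixes \<alpha> \<beta> k :: nat
    and \<C> :: "(z4 ^ 'n) set"
    and C :: "(bit ^ 'n) set"
  assumes "(\<alpha>, \<beta>) \<in> {(2, 2), (4, 4), (6, 4), (10, 4)}"
    and "CARD('n) = 24 * k + \<alpha>"
    and "self_dual \<C>"
    and "min_lee_weight \<C> = 8 * k + \<beta>"
    and "self_dual C"
    and "residue_code \<C> \<subseteq> C"
  shows "s_extremal C \<and> self_dual C \<and> min_weight C = 4 * k + 2"
proof -
  note C = assms(5)
  define h where "h = \<alpha> div 2"
  define m where "m = 12 * k + h"
  have \<alpha>: "\<alpha> = 2 * h" "h \<in> {1, 2, 3, 5}" "\<alpha> \<in> {2, 4, 6, 10}" and \<beta>: "\<beta> \<in> {2, 4}" "2 * h < \<beta> + 8"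
    using assms(1) by (auto simp: h_def)
  have n: "CARD('n) = 2 * m" using assms(2) \<alpha>(1) by (simp add: m_def)
  \<comment> \<open>\<open>m\<close> is congruent to \<open>h\<close> modulo 4, and \<open>h\<close>
    is 1, 2, 3 or 5.\<close>
  have "\<not> 4 dvd m" using \<alpha>(2) unfolding m_def by (elim insertE emptyE; simp; presburger)
  then have se: "singly_even C" by (rule self_dual_singly_even[OF C n])
  have "residue_code \<C> \<subseteq> doubly_even_subcode C"
    using residue_doubly_even[OF assms(3)] assms(6) by (auto simp: doubly_even_subcode_def)
  then have dual_sub: "dual (doubly_even_subcode C) \<subseteq> dual (residue_code \<C>)"
    by (auto simp: dual_def)
  have weight_ge: "8 * k + \<beta> \<le> 2 * weight v" if "v \<in> dual (doubly_even_subcode C)" "v \<noteq> 0" for v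
    using weight_dual_residue_ge[OF assms(3), of v] that dual_sub assms(4) by auto
  have C_ge: "4 * k + 2 \<le> weight c" if "c \<in> C" "c \<noteq> 0" for c
  proof -
    \<comment> \<open>The Lee weight bound with \<beta> = 2 gives only \<open>4k + 1\<close>;
      evenness supplies the missing unit.\<close>
    have "4 * k + 1 \<le> weight c"
      using weight_ge[of c] that subset_dual_doubly_even_subcode[OF C] \<beta>(1) by auto
    moreover have "even (weight c)" using self_dual_even_weight[OF C that(1)] .
    ultimately show ?thesis by presburger
  qed
  obtain a where a0: "\<And>j. m div 4 < j \<Longrightarrow> a j = 0"
    and a: "weight_poly C = (\<Sum>j\<le>m div 4. smult (a j) ([:1, 0, 1:] ^ (m - 4 * j) * gleason8 ^ j))"
    using gleason_weight_poly[OF C n] by blast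
  have m_pos: "0 < m" using \<alpha>(2) by (auto simp: m_def)
  have a_2k: "a (2 * k) \<noteq> 0"
  proof -
    obtain R where "(\<Sum>j\<le>m div 4. fps_const (a j) * ((1 + fps_X) ^ (m - 4 * j) * (fps_X * (1 - fps_X) ^ 2) ^ j))
      = 1 + fps_X ^ (2 * k + 1) * R"
      using weight_fps_expansion[OF C a, of "2 * k + 1"] C_ge by force
    from expansion_coeff_even[OF this a0 _ m_def m_pos] show ?thesis by simp
  qed
  have "finite {j. a j \<noteq> 0}"
    by (rule finite_subset[of _ "{..m div 4}"]) (use a0 in \<open>auto simp: not_less[symmetric]\<close>)
  define J where "J = Max {j. a j \<noteq> 0}"
  have J: "a J \<noteq> 0"
    using Max_in[OF \<open>finite {j. a j \<noteq> 0}\<close>] a_2k unfolding J_def by blast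
  have J_max: "a j = 0" if "J < j" for j
    using Max_ge[OF \<open>finite {j. a j \<noteq> 0}\<close>, of j] that unfolding J_def by force
  have J_le: "J \<le> m div 4" using J a0 not_less by blast
  have "2 * k \<le> J" using a_2k J_max not_less by blast
  note shadow = min_weight_shadow[OF C n se a J J_le J_max]
  obtain s where s: "s \<in> shadow C" "weight s = m - 4 * J" using shadow(2) by blast
  have "s \<noteq> 0" using s(1) self_dual_zero[OF C] by (auto simp: shadow_def)
  then have "8 * k + \<beta> \<le> 2 * (m - 4 * J)"
    using weight_ge[of s] s by (auto simp: shadow_def)
  \<comment> \<open>With \<open>m = 12k + h\<close> the bound becomes
    \<open>8J \<le> 16k + 2h - \<beta>\<close>, which is below \<open>16k + 8\<close>.\<close>
  then have "J \<le> 2 * k" using \<beta>(2) J_le unfolding m_def by linarith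
  then have J_eq: "J = 2 * k" using \<open>2 * k \<le> J\<close> by simp
  have d_shadow: "min_weight (shadow C) = 4 * k + h" using shadow(1) by (simp add: J_eq m_def)
  have "\<exists>c\<in>C. c \<noteq> 0 \<and> weight c = 4 * k + 2"
  proof (rule ccontr)
    assume none: "\<not> ?thesis"
    \<comment> \<open>Without weight \<open>4k + 2\<close>, even weights jump to
      \<open>4k + 4\<close>. This widens the gap enough to reach index \<open>2k + 1\<close>, whose
      nonzero coefficient contradicts the maximality of \<open>J\<close>.\<close>
    have "2 * (2 * k + 2) \<le> weight c" if "c \<in> C" "c \<noteq> 0" for c
    proof -
      have "even (weight c)" using self_dual_even_weight[OF C that(1)] .
      moreover have "weight c \<noteq> 4 * k + 2" using none that by blast
      ultimately show ?thesis using C_ge[OF that] by presburger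
    qed
    then obtain R where "(\<Sum>j\<le>m div 4. fps_const (a j) * ((1 + fps_X) ^ (m - 4 * j) * (fps_X * (1 - fps_X) ^ 2) ^ j))
      = 1 + fps_X ^ (2 * k + 2) * R"
      using weight_fps_expansion[OF C a, of "2 * k + 2"] by blast
    from expansion_coeff_odd[OF this a0 _ m_def m_pos] have "a (2 * k + 1) \<noteq> 0" 
      using \<alpha>(2) by auto
    then show False using J_max[of "2 * k + 1"] by (simp add: J_eq)
  qed
  then obtain c where c: "c \<in> C" "c \<noteq> 0" "weight c = 4 * k + 2" by blast
  have d: "min_weight C = 4 * k + 2"
    unfolding min_weight_def
    by (rule Min_eqI) (use c C_ge in \<open>auto intro: rev_image_eqI\<close>)
  \<comment> \<open>The length is \<alpha> modulo 24, with \<alpha> at most 10, so the exceptional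
    case of the bound does not arise.\<close>
  have "CARD('n) mod 24 \<noteq> 22" using assms(2) \<alpha>(3) by auto
  moreover have "real (4 * k + h) = real CARD('n) / 2 + 4 - 2 * real (4 * k + 2)"
    unfolding n m_def by simp
  ultimately show ?thesis
    unfolding s_extremal_def d d_shadow using se C by simp
qed

end
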